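(* Assume $\mathrm{cf}(2^{\aleph_0})=\aleph_1$. Then every non-trivial $\aleph_1$-closed forcing notion of size $\leq 2^{\aleph_0}$ is forcing equivalent to $\mathrm{Add}(\aleph_1,1)$.
   Context: $\mathrm{Add}(\kappa,1)$ is the Cohen forcing for adding a Cohen subset of $\kappa$: conditions are partial functions $p:\kappa\to\{0,1\}$ with $|p|<\kappa$, ordered by reverse inclusion. Forcing notions are taken to be non-trivial and separative. Two forcing notions $\mathbb{P},\mathbb{Q}$ are forcing equivalent ($\mathbb{P}\simeq\mathbb{Q}$) iff their Boolean completions $RO(\mathbb{P})$ and $RO(\mathbb{Q})$ are isomorphic. A forcing notion is $\aleph_1$-closed if every decreasing sequence of conditions of countable length has a lower bound. *)

theory Defs
  imports Main
begin

definition cofinal_in :: "'a rel \<Rightarrow> 'a set \<Rightarrow> bool" where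
  "cofinal_in r X \<longleftrightarrow> X \<subseteq> Field r \<and> (\<forall>a\<in>Field r. \<exists>b\<in>X. (a, b) \<in> r)"

definition has_cofinality :: "'a rel \<Rightarrow> 'b rel \<Rightarrow> bool" where
  "has_cofinality r k \<longleftrightarrow>
     (\<exists>X. cofinal_in r X \<and> (card_of X, k) \<in> ordIso) \<and>
     (\<forall>X. cofinal_in r X \<longrightarrow> (k, card_of X) \<in> ordLeq)"

abbreviation continuum :: "nat set rel" where
  "continuum \<equiv> card_of (UNIV :: nat set set)"

abbreviation aleph1 :: "nat set rel" where
  "aleph1 \<equiv> cardSuc natLeq"

text \<open>A forcing notion is a nonempty preordered set (P, le), where
  le q p means q is stronger than (extends) p.\<close>
definition compatible :: "'a set \<Rightarrow> ('a \<Rightarrow> 'a \<Rightarrow> bool) \<Rightarrow> 'a \<Rightarrow> 'a \<Rightarrow> bool" where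
  "compatible P le p q \<longleftrightarrow> (\<exists>r\<in>P. le r p \<and> le r q)"

definition separative :: "'a set \<Rightarrow> ('a \<Rightarrow> 'a \<Rightarrow> bool) \<Rightarrow> bool" where
  "separative P le \<longleftrightarrow>
     (\<forall>p\<in>P. \<forall>q\<in>P. \<not> le p q \<longrightarrow> (\<exists>r\<in>P. le r p \<and> \<not> compatible P le r q))"

definition nontrivial :: "'a set \<Rightarrow> ('a \<Rightarrow> 'a \<Rightarrow> bool) \<Rightarrow> bool" where
  "nontrivial P le \<longleftrightarrow>
     (\<forall>p\<in>P. \<exists>q\<in>P. \<exists>r\<in>P. le q p \<and> le r p \<and> \<not> compatible P le q r)"

definition forcing_notion :: "'a set \<Rightarrow> ('a \<Rightarrow> 'a \<Rightarrow> bool) \<Rightarrow> bool" where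
  "forcing_notion P le \<longleftrightarrow>
     P \<noteq> {} \<and>
     (\<forall>p\<in>P. le p p) \<and>
     (\<forall>p\<in>P. \<forall>q\<in>P. \<forall>r\<in>P. le p q \<longrightarrow> le q r \<longrightarrow> le p r) \<and>
     separative P le \<and> nontrivial P le"

text \<open>aleph_1-closed: every decreasing sequence of countable length has a lower bound.
  Countable lengths (countable ordinals) are represented by well-orders on subsets of nat.\<close>
definition aleph1_closed :: "'a set \<Rightarrow> ('a \<Rightarrow> 'a \<Rightarrow> bool) \<Rightarrow> bool" where
  "aleph1_closed P le \<longleftrightarrow>
     (\<forall>(r :: nat rel) (f :: nat \<Rightarrow> 'a). Well_order r \<longrightarrow>
        f ` Field r \<subseteq> P \<longrightarrow>
        (\<forall>i j. (i, j) \<in> r \<longrightarrow> le (f j) (f i)) \<longrightarrow>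
        (\<exists>q\<in>P. \<forall>i\<in>Field r. le q (f i)))"

text \<open>Topology on P whose open sets are the downward closed sets; basic open sets are cones.\<close>
definition cone :: "'a set \<Rightarrow> ('a \<Rightarrow> 'a \<Rightarrow> bool) \<Rightarrow> 'a \<Rightarrow> 'a set" where
  "cone P le p = {q\<in>P. le q p}"

definition po_interior :: "'a set \<Rightarrow> ('a \<Rightarrow> 'a \<Rightarrow> bool) \<Rightarrow> 'a set \<Rightarrow> 'a set" where
  "po_interior P le X = {p\<in>P. cone P le p \<subseteq> X}"

definition po_closure :: "'a set \<Rightarrow> ('a \<Rightarrow> 'a \<Rightarrow> bool) \<Rightarrow> 'a set \<Rightarrow> 'a set" where
  "po_closure P le X = {p\<in>P. cone P le p \<inter> X \<noteq> {}}"

text \<open>RO(P): the regular open subsets of P, ordered by inclusion (its Boolean completion).\<close>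
definition RO :: "'a set \<Rightarrow> ('a \<Rightarrow> 'a \<Rightarrow> bool) \<Rightarrow> 'a set set" where
  "RO P le = {U. U \<subseteq> P \<and> po_interior P le (po_closure P le U) = U}"

text \<open>Boolean algebra isomorphism of the regular open algebras = inclusion-order isomorphism.\<close>
definition forcing_equivalent ::
  "'a set \<Rightarrow> ('a \<Rightarrow> 'a \<Rightarrow> bool) \<Rightarrow> 'b set \<Rightarrow> ('b \<Rightarrow> 'b \<Rightarrow> bool) \<Rightarrow> bool" where
  "forcing_equivalent P le Q le' \<longleftrightarrow>
     (\<exists>h. bij_betw h (RO P le) (RO Q le') \<and>
          (\<forall>U\<in>RO P le. \<forall>V\<in>RO P le. U \<subseteq> V \<longleftrightarrow> h U \<subseteq> h V))"

text \<open>omega_1 is the field of the cardinal well-order aleph1. Conditions: partial functions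
  from omega_1 to {0,1} (bool) with domain of size < aleph_1; ordered by reverse inclusion.\<close>
definition Add_aleph1 :: "(nat set \<Rightarrow> bool option) set" where
  "Add_aleph1 = {p. dom p \<subseteq> Field aleph1 \<and> (card_of (dom p), aleph1) \<in> ordLess}"

definition Add_le :: "(nat set \<Rightarrow> bool option) \<Rightarrow> (nat set \<Rightarrow> bool option) \<Rightarrow> bool" where
  "Add_le q p \<longleftrightarrow> p \<subseteq>\<^sub>m q"

end

theory Submission
  imports Defs "HOL-Library.Countable_Set"
begin

text \<open>
  An \<open>\<aleph>\<^sub>1\<close>-closed \<open>P\<close> of size at most the continuum \<open>c\<close> has a dense subset isomorphic to one fixed tree,
  the sequences of countable successor length with entries in a set of size \<open>c\<close>; since
  \<open>Add(\<aleph>\<^sub>1,1)\<close> is itself such a \<open>P\<close>, both have the regular open algebra of this tree.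
  The tree is built by recursion: the successors of a branch of countable length form an antichain
  of size \<open>c\<close>, maximal among the lower bounds of the branch, which exist by closure. For density,
  cofinality \<open>\<aleph>\<^sub>1\<close> allows to write \<open>P\<close> as a union of pieces \<open>J \<alpha>\<close>, \<open>\<alpha> < \<omega>\<^sub>1\<close>, of size less
  than \<open>c\<close>, and the antichains at level \<open>\<alpha>\<close> are chosen so as to have a member below each condition in
  \<open>J \<alpha>\<close> compatible with the branch. Such antichains exist because fewer than \<open>c\<close> conditions,
  each with \<open>c\<close> pairwise incompatible extensions, can be extended to pairwise incompatible ones.
\<close>

section \<open>Dense embeddings and regular open algebras\<close>

text \<open>Separated from \<open>forcing_notion\<close> so that the tree, a preorder with many
  names for one sequence, is treated on the same footing as \<open>P\<close>.\<close>

definition preorder_on_set :: "'a set \<Rightarrow> ('a \<Rightarrow> 'a \<Rightarrow> bool) \<Rightarrow> bool" where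
  "preorder_on_set P le \<longleftrightarrow>
     (\<forall>p\<in>P. le p p) \<and> (\<forall>p\<in>P. \<forall>q\<in>P. \<forall>r\<in>P. le p q \<longrightarrow> le q r \<longrightarrow> le p r)"

text \<open>A condition lies in the interior of the closure of \<open>U\<close> exactly when
  \<open>U\<close> is dense below it, so regularity can be tested pointwise.\<close>

lemma RO_iff: "U \<in> RO P le \<longleftrightarrow>
    U \<subseteq> P \<and> (\<forall>p\<in>P. p \<in> U \<longleftrightarrow> (\<forall>q\<in>P. le q p \<longrightarrow> (\<exists>r\<in>U. le r q)))"
proof (cases "U \<subseteq> P")
  case True
  have "\<And>p. p \<in> po_interior P le (po_closure P le U) \<longleftrightarrow>
      p \<in> P \<and> (\<forall>q\<in>P. le q p \<longrightarrow> (\<exists>r\<in>U. le r q))"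
    unfolding po_interior_def po_closure_def cone_def using True by auto
  then have "po_interior P le (po_closure P le U) = U \<longleftrightarrow>
     (\<forall>p. (p \<in> P \<and> (\<forall>q\<in>P. le q p \<longrightarrow> (\<exists>r\<in>U. le r q))) \<longleftrightarrow> p \<in> U)"
    unfolding set_eq_iff by simp
  also have "\<dots> \<longleftrightarrow> (\<forall>p\<in>P. p \<in> U \<longleftrightarrow> (\<forall>q\<in>P. le q p \<longrightarrow> (\<exists>r\<in>U. le r q)))"
    using True by auto
  finally show ?thesis using True by (simp add: RO_def)
qed (simp add: RO_def)

lemma RO_subset: "U \<in> RO P le \<Longrightarrow> U \<subseteq> P"
  by (simp add: RO_def)

lemma RO_memI:
  assumes "U \<in> RO P le" "p \<in> P" "\<And>q. q \<in> P \<Longrightarrow> le q p \<Longrightarrow> \<exists>r\<in>U. le r q"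
  shows "p \<in> U"
  using assms(1)[unfolded RO_iff, THEN conjunct2, THEN bspec, OF assms(2)] assms(3) by simp

text \<open>\<open>U\<close> is dense below \<open>p\<close>, hence also below the stronger
  \<open>q\<close>, and regularity puts \<open>q\<close> into \<open>U\<close>.\<close>

lemma RO_down:
  assumes "preorder_on_set P le" "U \<in> RO P le" "p \<in> U" "q \<in> P" "le q p"
  shows "q \<in> U"
proof -
  note U = assms(2)[unfolded RO_iff, THEN conjunct1]
    and reg = assms(2)[unfolded RO_iff, THEN conjunct2, THEN bspec]
  have "p \<in> P" using U assms(3) by blast
  show ?thesis
  proof (rule RO_memI[OF assms(2,4)])
    fix s assume s: "s \<in> P" "le s q"
    have "le s p"
      using assms(1) s assms(4,5) \<open>p \<in> P\<close> unfolding preorder_on_set_def by blast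
    then show "\<exists>r\<in>U. le r s" using reg[OF \<open>p \<in> P\<close>] assms(3) s by simp
  qed
qed

text \<open>\<open>e\<close> may identify elements of \<open>Q\<close>; this matters for the tree,
  where many pairs name the same sequence.\<close>

definition dense_embedding ::
  "'q set \<Rightarrow> ('q \<Rightarrow> 'q \<Rightarrow> bool) \<Rightarrow> 'a set \<Rightarrow> ('a \<Rightarrow> 'a \<Rightarrow> bool) \<Rightarrow> ('q \<Rightarrow> 'a) \<Rightarrow> bool" where
  "dense_embedding Q leQ P le e \<longleftrightarrow>
     e ` Q \<subseteq> P \<and>
     (\<forall>q\<in>Q. \<forall>q'\<in>Q. leQ q q' \<longrightarrow> le (e q) (e q')) \<and>
     (\<forall>q\<in>Q. \<forall>q'\<in>Q. compatible P le (e q) (e q') \<longrightarrow> compatible Q leQ q q') \<and>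
     (\<forall>p\<in>P. \<exists>q\<in>Q. le (e q) p)"

text \<open>Regular open sets are determined by their members in a dense set, so taking preimages
  under \<open>e\<close> is an isomorphism of the algebras.\<close>

lemma dense_embedding_forcing_equivalent:
  assumes Q: "preorder_on_set Q leQ" and P: "preorder_on_set P le"
    and e: "dense_embedding Q leQ P le e"
  shows "forcing_equivalent P le Q leQ"
proof -
  have reflP: "\<And>p. p \<in> P \<Longrightarrow> le p p" and reflQ: "\<And>q. q \<in> Q \<Longrightarrow> leQ q q"
    and transP: "\<And>p q r. \<lbrakk>p \<in> P; q \<in> P; r \<in> P; le p q; le q r\<rbrakk> \<Longrightarrow> le p r"
    using P Q unfolding preorder_on_set_def by blast+
  have eP: "\<And>q. q \<in> Q \<Longrightarrow> e q \<in> P"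
    and mono: "\<And>q q'. \<lbrakk>q \<in> Q; q' \<in> Q; leQ q q'\<rbrakk> \<Longrightarrow> le (e q) (e q')"
    and compat: "\<And>q q' p. \<lbrakk>q \<in> Q; q' \<in> Q; p \<in> P; le p (e q); le p (e q')\<rbrakk>
      \<Longrightarrow> \<exists>r\<in>Q. leQ r q \<and> leQ r q'"
    and dense: "\<And>p. p \<in> P \<Longrightarrow> \<exists>q\<in>Q. le (e q) p"
    using e unfolding dense_embedding_def compatible_def by blast+
  \<comment> \<open>Density gives some \<open>q1\<close> with image below \<open>p\<close>. It is
    compatible with \<open>q\<close> because the images are, and a common extension in
    \<open>Q\<close> is as required.\<close>
  have below: "\<exists>q'\<in>Q. leQ q' q \<and> le (e q') p" if qQ: "q \<in> Q" and pP: "p \<in> P" and "le p (e q)" for q p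
  proof -
    obtain q1 where q1: "q1 \<in> Q" "le (e q1) p" using dense \<open>p \<in> P\<close> by blast
    have "le (e q1) (e q)" using transP eP q1 that by blast
    then obtain r where "r \<in> Q" "leQ r q1" "leQ r q"
      using compat[OF q1(1) qQ eP[OF q1(1)]] q1 \<open>le (e q1) (e q)\<close> reflP eP by blast
    then have "le (e r) p" using transP[OF eP eP pP] mono q1 by blast
    then show ?thesis using \<open>r \<in> Q\<close> \<open>leQ r q\<close> by blast
  qed
  \<comment> \<open>\<open>h\<close> pulls regular open sets back along \<open>e\<close>. Its
    inverse \<open>g\<close> collects the conditions below which the image of \<open>V\<close> is
    dense.\<close>
  define h where "h U = {q \<in> Q. e q \<in> U}" for U
  define g where "g V = {p \<in> P. \<forall>p'\<in>P. le p' p \<longrightarrow> (\<exists>q\<in>V. le (e q) p')}" for V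
  have hRO: "h U \<in> RO Q leQ" if U: "U \<in> RO P le" for U
    unfolding RO_iff
  proof (intro conjI ballI iffI impI)
    show "h U \<subseteq> Q" by (auto simp: h_def)
  next
    fix q q' assume "q \<in> Q" "q \<in> h U" "q' \<in> Q" "leQ q' q"
    then have "e q' \<in> U" using RO_down[OF P U, of "e q" "e q'"] mono eP by (simp add: h_def)
    then show "\<exists>r\<in>h U. leQ r q'"
      using \<open>q' \<in> Q\<close> reflQ unfolding h_def by blast
  next
    fix q assume q: "q \<in> Q" and *: "\<forall>q'\<in>Q. leQ q' q \<longrightarrow> (\<exists>r\<in>h U. leQ r q')"
    have "\<exists>r\<in>U. le r p" if p: "p \<in> P" "le p (e q)" for p
    proof -
      obtain q' where q': "q' \<in> Q" "leQ q' q" "le (e q') p" using below q p by blast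
      then obtain r where "r \<in> Q" "e r \<in> U" "leQ r q'" using * by (auto simp: h_def)
      then show ?thesis using q' p mono transP eP by blast
    qed
    then show "q \<in> h U" using RO_memI[OF U eP] q by (simp add: h_def)
  qed
  have gRO: "g V \<in> RO P le" if V: "V \<in> RO Q leQ" for V
    unfolding RO_iff
  proof (intro conjI ballI iffI impI)
    show "g V \<subseteq> P" by (auto simp: g_def)
  next
    fix p p' assume "p \<in> P" "p \<in> g V" "p' \<in> P" "le p' p"
    then have "p' \<in> g V" using transP[of _ p' p] unfolding g_def by blast
    then show "\<exists>r\<in>g V. le r p'"
      using reflP[OF \<open>p' \<in> P\<close>] by blast
  next
    fix p assume p: "p \<in> P" and *: "\<forall>q\<in>P. le q p \<longrightarrow> (\<exists>r\<in>g V. le r q)"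
    have "\<exists>q\<in>V. le (e q) p'" if p': "p' \<in> P" "le p' p" for p'
    proof -
      obtain r where r: "r \<in> P" "le r p'" "r \<in> g V" using * p' by (auto simp: g_def)
      then obtain q where "q \<in> V" "le (e q) r" using reflP by (auto simp: g_def)
      moreover have "q \<in> Q" using RO_subset[OF V] \<open>q \<in> V\<close> by blast
      ultimately show ?thesis using r p' transP eP by blast
    qed
    then show "p \<in> g V" using p by (auto simp: g_def)
  qed
  have hg: "h (g V) = V" if V: "V \<in> RO Q leQ" for V
  proof (intro set_eqI iffI)
    fix q assume "q \<in> h (g V)"
    then have q: "q \<in> Q" "e q \<in> g V" by (auto simp: h_def)
    have "\<exists>r\<in>V. leQ r q'" if q': "q' \<in> Q" "leQ q' q" for q'
    proof -
      obtain v where v: "v \<in> V" "le (e v) (e q')"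
        using q q' mono eP unfolding g_def by blast
      have "v \<in> Q" using RO_subset[OF V] v by blast
      then obtain w where "w \<in> Q" "leQ w v" "leQ w q'"
        using compat[OF _ q'(1) eP[of v]] v reflP[OF eP[of v]] by blast
      then show ?thesis using RO_down[OF Q V v(1)] by blast
    qed
    then show "q \<in> V" using RO_memI[OF V] q by blast
  next
    fix q assume q: "q \<in> V"
    then have "q \<in> Q" using RO_subset[OF V] by blast
    have "\<exists>q\<in>V. le (e q) p" if p: "p \<in> P" "le p (e q)" for p
      using below[OF \<open>q \<in> Q\<close> p] RO_down[OF Q V q] by blast
    then show "q \<in> h (g V)" using \<open>q \<in> Q\<close> eP by (auto simp: h_def g_def)
  qed
  \<comment> \<open>\<open>h\<close> reflects inclusion: below any member of \<open>U\<close> lie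
    images of elements of \<open>h U\<close>, so \<open>V\<close> is dense below it. This yields
    both injectivity and the order isomorphism.\<close>
  have sub: "U \<subseteq> V" if U: "U \<in> RO P le" and V: "V \<in> RO P le" and hUV: "h U \<subseteq> h V" for U V
  proof
    fix p assume p: "p \<in> U"
    then have "p \<in> P" using RO_subset[OF U] by blast
    have "\<exists>r\<in>V. le r p'" if p': "p' \<in> P" "le p' p" for p'
    proof -
      obtain q where q: "q \<in> Q" "le (e q) p'" using dense p' by blast
      have "le (e q) p" using q p' transP eP \<open>p \<in> P\<close> by blast
      then have "q \<in> h U" using q RO_down[OF P U p] eP by (auto simp: h_def)
      then show ?thesis using hUV q by (auto simp: h_def)
    qed
    then show "p \<in> V" using RO_memI[OF V \<open>p \<in> P\<close>] by blast
  qed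
  have "bij_betw h (RO P le) (RO Q leQ)"
  proof (rule bij_betw_imageI)
    show "inj_on h (RO P le)"
      by (rule inj_onI, rule subset_antisym) (rule sub; simp)+
    show "h ` RO P le = RO Q leQ"
    proof (intro subset_antisym image_subsetI subsetI)
      show "V \<in> h ` RO P le" if "V \<in> RO Q leQ" for V
        by (rule image_eqI[where x = "g V"]) (simp_all add: hg gRO that)
    qed (rule hRO)
  qed
  moreover have "U \<subseteq> V \<longleftrightarrow> h U \<subseteq> h V" if "U \<in> RO P le" "V \<in> RO P le" for U V
    using sub[OF that] by (auto simp: h_def)
  ultimately show ?thesis unfolding forcing_equivalent_def by (intro exI conjI ballI)
qed

lemma forcing_equivalentE:
  assumes "forcing_equivalent P le Q leQ"
  obtains h where "bij_betw h (RO P le) (RO Q leQ)"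
    "\<And>U V. \<lbrakk>U \<in> RO P le; V \<in> RO P le\<rbrakk> \<Longrightarrow> U \<subseteq> V \<longleftrightarrow> h U \<subseteq> h V"
  using assms unfolding forcing_equivalent_def by (elim exE conjE) (rule that, simp_all)

lemma forcing_equivalent_sym:
  assumes "forcing_equivalent P le Q leQ"
  shows "forcing_equivalent Q leQ P le"
proof -
  obtain h where h: "bij_betw h (RO P le) (RO Q leQ)"
    and mono: "\<And>U V. \<lbrakk>U \<in> RO P le; V \<in> RO P le\<rbrakk> \<Longrightarrow> U \<subseteq> V \<longleftrightarrow> h U \<subseteq> h V"
    by (rule forcing_equivalentE[OF assms]) (rule that)
  let ?g = "inv_into (RO P le) h"
  have "bij_betw ?g (RO Q leQ) (RO P le)" using h by (rule bij_betw_inv_into)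
  moreover have "U \<subseteq> V \<longleftrightarrow> ?g U \<subseteq> ?g V" if "U \<in> RO Q leQ" "V \<in> RO Q leQ" for U V
    using mono[of "?g U" "?g V"] that h calculation
    by (simp add: bij_betw_inv_into_right bij_betwE)
  ultimately show ?thesis unfolding forcing_equivalent_def by (intro exI conjI ballI)
qed

lemma forcing_equivalent_trans:
  assumes "forcing_equivalent P le Q leQ" and "forcing_equivalent Q leQ R leR"
  shows "forcing_equivalent P le R leR"
proof -
  obtain h where h: "bij_betw h (RO P le) (RO Q leQ)"
      "\<And>U V. \<lbrakk>U \<in> RO P le; V \<in> RO P le\<rbrakk> \<Longrightarrow> U \<subseteq> V \<longleftrightarrow> h U \<subseteq> h V"
    by (rule forcing_equivalentE[OF assms(1)]) (rule that)
  obtain k where k: "bij_betw k (RO Q leQ) (RO R leR)"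
      "\<And>U V. \<lbrakk>U \<in> RO Q leQ; V \<in> RO Q leQ\<rbrakk> \<Longrightarrow> U \<subseteq> V \<longleftrightarrow> k U \<subseteq> k V"
    by (rule forcing_equivalentE[OF assms(2)]) (rule that)
  have "bij_betw (k \<circ> h) (RO P le) (RO R leR)" using h(1) k(1) by (rule bij_betw_trans)
  moreover have "U \<subseteq> V \<longleftrightarrow> (k \<circ> h) U \<subseteq> (k \<circ> h) V" if "U \<in> RO P le" "V \<in> RO P le" for U V
    using h k that by (simp add: bij_betwE)
  ultimately show ?thesis unfolding forcing_equivalent_def by (intro exI conjI ballI)
qed

section \<open>Countable closure\<close>

unbundle cardinal_syntax

lemma card_order_aleph1: "Card_order aleph1"
  by (simp add: cardSuc_Card_order natLeq_Card_order)

lemma well_order_aleph1: "Well_order aleph1"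
  by (simp add: cardSuc_Well_order natLeq_Card_order)

text \<open>Being smaller than a successor cardinal means being at most its predecessor, here
  \<omega>.\<close>

lemma card_of_less_aleph1_iff: "|A| <o aleph1 \<longleftrightarrow> countable A"
proof -
  have "|A| <o aleph1 \<longleftrightarrow> |A| \<le>o natLeq"
    by (simp add: cardSuc_ordLeq_ordLess natLeq_Card_order card_of_Card_order)
  also have "\<dots> \<longleftrightarrow> |A| \<le>o |UNIV :: nat set|"
    using card_of_nat ordLeq_ordIso_trans ordIso_symmetric by blast
  also have "\<dots> \<longleftrightarrow> countable A"
    unfolding card_of_ordLeq[symmetric] countable_def by simp
  finally show ?thesis .
qed

lemma countable_underS_aleph1: "countable (underS aleph1 \<alpha>)"
proof (cases "\<alpha> \<in> Field aleph1")
  case True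
  then show ?thesis
    using card_of_underS[OF card_order_aleph1] card_of_less_aleph1_iff by blast
next
  case False
  then have "underS aleph1 \<alpha> = {}" by (auto simp: underS_def Field_def)
  then show ?thesis by simp
qed

lemma uncountable_Field_aleph1: "\<not> countable (Field aleph1)"
  using card_of_less_aleph1_iff[of "Field aleph1"] card_of_Field_ordIso[OF card_order_aleph1]
    not_ordLess_ordIso by blast

lemma nat_less_continuum: "|UNIV :: nat set| <o continuum"
  using card_of_Pow[of "UNIV :: nat set"] by simp

lemma infinite_nat_set: "infinite (UNIV :: nat set set)"
  by (simp add: Finite_Set.finite_set)

text \<open>\<open>aleph1_closed\<close> speaks of well-orders on sets of naturals only. A countable
  part \<open>D\<close> of any well-order is carried there by an injection into the
  naturals.\<close>

lemma aleph1_closed_countable: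
  assumes closed: "aleph1_closed P le" and w: "Well_order w" and D: "D \<subseteq> Field w" "countable D"
    and f: "\<And>i. i \<in> D \<Longrightarrow> f i \<in> P"
    and mono: "\<And>i j. \<lbrakk>i \<in> D; j \<in> D; (i, j) \<in> w\<rbrakk> \<Longrightarrow> le (f j) (f i)"
  obtains q where "q \<in> P" "\<And>i. i \<in> D \<Longrightarrow> le q (f i)"
proof -
  obtain h :: "'b \<Rightarrow> nat" where h: "inj_on h D" using D(2) by (auto simp: countable_def)
  let ?w = "Restr w D" and ?g = "inv_into D h"
  have "Refl w" using w by (simp add: order_on_defs)
  then have Fw: "Field ?w = D" using Refl_Field_Restr2 D(1) by blast
  have wo: "Well_order (dir_image ?w h)"
    by (rule Well_order_dir_image[OF Well_order_Restr[OF w]]) (simp only: Fw h)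
  have Fd: "Field (dir_image ?w h) = h ` D" by (simp add: dir_image_Field Fw)
  have "\<exists>q\<in>P. \<forall>i\<in>Field (dir_image ?w h). le q ((f \<circ> ?g) i)"
  proof (rule closed[unfolded aleph1_closed_def, rule_format, OF wo])
    show "(f \<circ> ?g) ` Field (dir_image ?w h) \<subseteq> P" using f h by (auto simp: Fd)
    show "le ((f \<circ> ?g) j) ((f \<circ> ?g) i)" if "(i, j) \<in> dir_image ?w h" for i j
      using that mono h by (auto simp: dir_image_def)
  qed
  then obtain q where "q \<in> P" "\<forall>i\<in>D. le q (f i)" using h by (auto simp: Fd)
  then show thesis using that by blast
qed

lemma aleph1_closed_seq:
  assumes closed: "aleph1_closed P le"
    and f: "\<And>n. f n \<in> P" and mono: "\<And>m n :: nat. m \<le> n \<Longrightarrow> le (f n) (f m)"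
  obtains q where "q \<in> P" "\<And>n. le q (f n)"
  by (rule aleph1_closed_countable[OF closed natLeq_Well_order, of UNIV f])

    (use f mono that in \<open>auto simp: Field_natLeq, auto simp: natLeq_def\<close>)

text \<open>\<open>W\<close> picks lower bounds of the branches of a Cantor scheme below \<open>p\<close>.\<close>
lemma ex_continuum_antichain_below:
  assumes fn: "forcing_notion P le" and closed: "aleph1_closed P le" and p: "p \<in> P"
  shows "\<exists>W :: nat set \<Rightarrow> 'a. (\<forall>c. W c \<in> P \<and> le (W c) p) \<and>
    (\<forall>c d. c \<noteq> d \<longrightarrow> \<not> compatible P le (W c) (W d))"
proof -
  have refl: "\<And>p. p \<in> P \<Longrightarrow> le p p"
    and trans: "\<And>p q r. \<lbrakk>p \<in> P; q \<in> P; r \<in> P; le p q; le q r\<rbrakk> \<Longrightarrow> le p r"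
    and nontriv: "\<forall>p\<in>P. \<exists>q\<in>P. \<exists>r\<in>P. le q p \<and> le r p \<and> \<not> compatible P le q r"
    using fn unfolding forcing_notion_def nontrivial_def by blast+
  obtain L R where LR: "\<And>p. p \<in> P \<Longrightarrow> L p \<in> P \<and> R p \<in> P \<and> le (L p) p \<and> le (R p) p
      \<and> \<not> compatible P le (L p) (R p)"
    using nontriv by metis
  \<comment> \<open>The branch of the scheme coded by \<open>c\<close>: at stage \<open>n\<close> it
    goes left iff \<open>n\<close> is in \<open>c\<close>.\<close>
  define s where "s c = rec_nat p (\<lambda>n q. if n \<in> c then L q else R q)" for c :: "nat set"
  have s0: "s c 0 = p" and sS: "s c (Suc n) = (if n \<in> c then L (s c n) else R (s c n))" for c n
    by (simp_all add: s_def)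
  have sP: "s c n \<in> P" for c n by (induction n) (use p LR in \<open>auto simp: s0 sS\<close>)
  have step: "le (s c (Suc n)) (s c n)" for c n using LR sP by (simp add: sS)
  have mono: "le (s c n) (s c m)" if "m \<le> n" for c m n
    using that
  proof (induction n rule: dec_induct)
    case base then show ?case by (simp add: refl sP)
  next
    case (step n) then show ?case using trans[OF sP sP sP] \<open>\<And>n c. le (s c (Suc n)) (s c n)\<close> by blast
  qed
  have "\<exists>q\<in>P. \<forall>n. le q (s c n)" for c
    by (rule aleph1_closed_seq[OF closed, of "s c"]) (use sP mono in auto)
  then obtain W where W: "\<And>c. W c \<in> P" "\<And>c n. le (W c) (s c n)" by metis
  have "\<not> compatible P le (W c) (W d)" if "c \<noteq> d" for c d
  proof
    assume "compatible P le (W c) (W d)"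
    then obtain r where r: "r \<in> P" "le r (W c)" "le r (W d)" by (auto simp: compatible_def)
    \<comment> \<open>Up to the first difference \<open>n\<close> of \<open>c\<close> and
      \<open>d\<close> the branches agree. Then one turns left and the other right at the same node,
      so a common extension would contradict the choice of \<open>L\<close> and
      \<open>R\<close>.\<close>
    define n where "n = (LEAST n. (n \<in> c) \<noteq> (n \<in> d))"
    have ex: "\<exists>n. (n \<in> c) \<noteq> (n \<in> d)" using that by blast
    have n: "(n \<in> c) \<noteq> (n \<in> d)" unfolding n_def using ex by (rule LeastI_ex)
    have less: "(m \<in> c) = (m \<in> d)" if "m < n" for m using not_less_Least[of m] that n_def by blast
    have eq: "s c m = s d m" if "m \<le> n" for m
      using that by (induction m) (simp_all add: s0 sS less)
    have "le r (s c (Suc n))" "le r (s d (Suc n))" using trans[OF _ W(1) sP] r W by blast+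
    then have "compatible P le (L (s c n)) (R (s c n))"
      using n eq[of n] r unfolding compatible_def by (auto simp: sS split: if_splits)
    then show False using LR sP by blast
  qed
  then show ?thesis using W s0 by metis
qed

section \<open>Disjoint refinements and large antichains\<close>

text \<open>Otherwise \<open>A\<close> would be covered by two sets of size at most that of the
  infinite set \<open>K\<close>.\<close>

lemma Diff_not_ordLeq:
  assumes "infinite K" "\<not> |A| \<le>o |K|" "|B| \<le>o |K|"
  shows "\<not> |A - B| \<le>o |K|"
proof
  assume "|A - B| \<le>o |K|"
  then have "|(A - B) \<union> B| \<le>o |K|"
    by (rule card_of_Un_ordLeq_infinite_Field[rotated])
      (simp_all only: assms Field_card_of card_of_card_order_on not_False_eq_True)
  moreover have "|A| \<le>o |(A - B) \<union> B|" by (rule card_of_mono1) blast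
  ultimately show False using assms(2) ordLeq_transitive by blast
qed

text \<open>Recursion along a well-order of \<open>S\<close>: the values used before
  \<open>x\<close> are at most as many as the elements of \<open>K\<close>, so the larger set
  \<open>N x\<close> still contains a fresh one.\<close>

lemma ex_injective_choice:
  fixes S :: "'b set" and N :: "'b \<Rightarrow> 'c set" and K :: "'d set"
  assumes K: "infinite K" "|S| \<le>o |K|" and N: "\<And>x. x \<in> S \<Longrightarrow> \<not> |N x| \<le>o |K|"
  shows "\<exists>c. (\<forall>x\<in>S. c x \<in> N x) \<and> inj_on c S"
proof -
  let ?r = "|S|"
  have wo: "Well_order ?r" by (rule card_of_Well_order)
  have "wf (?r - Id)" using wo by (simp add: order_on_defs)
  then have "\<exists>c. \<forall>x. x \<in> S \<longrightarrow> c x \<in> N x \<and> c x \<notin> c ` {y. (y, x) \<in> ?r - Id}"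
  proof (rule dependent_wf_choice)
    fix c x
    show "\<exists>d. x \<in> S \<longrightarrow> d \<in> N x \<and> d \<notin> c ` {y. (y, x) \<in> ?r - Id}"
    proof (cases "x \<in> S")
      case True
      have "{y. (y, x) \<in> ?r - Id} \<subseteq> S" using Field_card_of[of S] by (auto simp: Field_def)
      then have "|c ` {y. (y, x) \<in> ?r - Id}| \<le>o |K|"
        by (rule ordLeq_transitive[OF card_of_image ordLeq_transitive[OF card_of_mono1 K(2)]])
      from Diff_not_ordLeq[OF K(1) N[OF True] this]
      have "N x - c ` {y. (y, x) \<in> ?r - Id} \<noteq> {}" by (metis card_of_empty)
      then show ?thesis by blast
    qed simp
  next
    fix f g :: "'b \<Rightarrow> 'c" and x d
    assume "\<And>z. (z, x) \<in> ?r - Id \<Longrightarrow> f z = g z"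
    then have "f ` {y. (y, x) \<in> ?r - Id} = g ` {y. (y, x) \<in> ?r - Id}" by (intro image_cong) auto
    then show "(x \<in> S \<longrightarrow> d \<in> N x \<and> d \<notin> f ` {y. (y, x) \<in> ?r - Id}) =
      (x \<in> S \<longrightarrow> d \<in> N x \<and> d \<notin> g ` {y. (y, x) \<in> ?r - Id})" by simp
  qed
  then obtain c where "\<forall>x. x \<in> S \<longrightarrow> c x \<in> N x \<and> c x \<notin> c ` {y. (y, x) \<in> ?r - Id}" ..
  note * = this[rule_format]
  have fresh: "c x \<noteq> c y" if "x \<in> S" "(y, x) \<in> ?r - Id" for x y
    using *[OF that(1)] that(2) by auto
  have "inj_on c S"
  proof (rule inj_onI, rule ccontr)
    fix x y assume xy: "x \<in> S" "y \<in> S" "c x = c y" "x \<noteq> y"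
    have "(x, y) \<in> ?r \<or> (y, x) \<in> ?r"
      using wo xy Field_card_of[of S] by (auto simp: order_on_defs total_on_def)
    then show False using xy fresh[of x y] fresh[of y x] by auto
  qed
  then show ?thesis using * by auto
qed

lemma compatible_sym: "compatible P le p q \<longleftrightarrow> compatible P le q p"
  by (auto simp: compatible_def)

lemma compatible_mono:
  assumes "preorder_on_set P le" "compatible P le p q" "le p p'" "le q q'"
    "p \<in> P" "p' \<in> P" "q \<in> P" "q' \<in> P"
  shows "compatible P le p' q'"
proof -
  have trans: "\<And>p q r. \<lbrakk>p \<in> P; q \<in> P; r \<in> P; le p q; le q r\<rbrakk> \<Longrightarrow> le p r"
    using assms(1) unfolding preorder_on_set_def by blast
  obtain r where r: "r \<in> P" "le r p" "le r q" using assms(2) by (auto simp: compatible_def)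
  then show ?thesis
    using trans[OF r(1) assms(5,6) r(2) assms(3)] trans[OF r(1) assms(7,8) r(3) assms(4)]
    unfolding compatible_def by blast
qed

text \<open>Send \<open>x\<close> to the first \<open>y\<close> for which it is compatible with many members of the antichain
  \<open>W y\<close>. Deleting from \<open>W y\<close> the few members compatible with a condition sent past \<open>y\<close> separates
  the conditions sent to different places; those sent to the same \<open>y\<close> are separated by choosing
  different members of \<open>W y\<close>.\<close>
lemma disjoint_refinement:
  fixes W :: "'a \<Rightarrow> nat set \<Rightarrow> 'a"
  assumes pre: "preorder_on_set P le" and S: "S \<subseteq> P" "|S| <o continuum"
    and W: "\<And>x c. x \<in> S \<Longrightarrow> W x c \<in> P \<and> le (W x c) x"
    and anti: "\<And>x c d. \<lbrakk>x \<in> S; c \<noteq> d\<rbrakk> \<Longrightarrow> \<not> compatible P le (W x c) (W x d)"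
  shows "\<exists>z. (\<forall>x\<in>S. z x \<in> P \<and> le (z x) x) \<and>
    (\<forall>x\<in>S. \<forall>y\<in>S. x \<noteq> y \<longrightarrow> \<not> compatible P le (z x) (z y))"
proof -
  \<comment> \<open>\<open>K\<close> is infinite, at least as large as \<open>S\<close>, and smaller
    than the continuum. A set of indices counts as large if its size exceeds that of
    \<open>K\<close>.\<close>
  define K where "K = S <+> (UNIV :: nat set)"
  have K: "infinite K" by (simp add: K_def finite_Plus_iff)
  have SK: "|S| \<le>o |K|" unfolding K_def by (rule card_of_Plus1)
  have "|K| <o continuum"
    unfolding K_def by (rule card_of_Plus_ordLess_infinite[OF infinite_nat_set S(2) nat_less_continuum])
  then have big: "\<not> |UNIV :: nat set set| \<le>o |K|" by (rule not_ordLess_ordLeq[rotated])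
  let ?r = "|S|"
  have wo: "Well_order ?r" by (rule card_of_Well_order)
  have rS: "Field ?r = S" by (rule Field_card_of)
  have wf: "wf (?r - Id)" using wo by (simp add: order_on_defs)
  define N where "N x y = {c. compatible P le (W y c) x}" for x y
  \<comment> \<open>\<open>x\<close> is compatible with every member of \<open>W x\<close>, so the
    set of places where it meets many members is nonempty and has a first element, later called
    \<open>i x\<close>.\<close>
  have Nself: "N x x = UNIV" if "x \<in> S" for x
    using W[OF that] pre unfolding N_def compatible_def preorder_on_set_def by blast
  have "\<exists>y. y \<in> S \<and> \<not> ( |N x y| \<le>o |K| ) \<and> (\<forall>y'. (y', y) \<in> ?r - Id \<longrightarrow> ( |N x y'| \<le>o |K| ))"
    if x: "x \<in> S" for x
  proof -
    have "x \<in> {y \<in> S. \<not> |N x y| \<le>o |K|}" using x big by (simp add: Nself)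
    from wfE_min[OF wf this] obtain y where "y \<in> S" "\<not> |N x y| \<le>o |K|"
      and min: "\<And>y'. (y', y) \<in> ?r - Id \<Longrightarrow> y' \<notin> {y \<in> S. \<not> |N x y| \<le>o |K|}" by blast
    moreover have "|N x y'| \<le>o |K|" if "(y', y) \<in> ?r - Id" for y'
      using min[OF that] that rS FieldI1[of y' y ?r] by blast
    ultimately show ?thesis by blast
  qed
  then obtain i where iS: "\<And>x. x \<in> S \<Longrightarrow> i x \<in> S" and iN: "\<And>x. x \<in> S \<Longrightarrow> \<not> |N x (i x)| \<le>o |K|"
    and imin: "\<And>x y. \<lbrakk>x \<in> S; (y, i x) \<in> ?r - Id\<rbrakk> \<Longrightarrow> |N x y| \<le>o |K|" by metis
  \<comment> \<open>The indices deleted at \<open>y\<close>: those of members of \<open>W y\<close>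
    compatible with some condition sent strictly past \<open>y\<close>. Each such condition
    contributes few by minimality of \<open>i\<close>, and there are few conditions.\<close>
  define B where "B y = (\<Union>x \<in> {x \<in> S. (y, i x) \<in> ?r - Id}. N x y)" for y
  have B: "|B y| \<le>o |K|" for y
    unfolding B_def
  proof (rule card_of_UNION_ordLeq_infinite[OF K])
    show "|{x \<in> S. (y, i x) \<in> ?r - Id}| \<le>o |K|"
      by (rule ordLeq_transitive[OF card_of_mono1 SK]) blast
  qed (use imin in blast)
  obtain c where c: "\<And>x. x \<in> S \<Longrightarrow> c x \<in> N x (i x) - B (i x)" and inj: "inj_on c S"
    using ex_injective_choice[OF K SK, of "\<lambda>x. N x (i x) - B (i x)"] Diff_not_ordLeq[OF K iN B]
    by blast
  have "\<exists>z\<in>P. le z (W (i x) (c x)) \<and> le z x" if "x \<in> S" for x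
    using c[OF that] by (auto simp: N_def compatible_def)
  then obtain z where z: "\<And>x. x \<in> S \<Longrightarrow> z x \<in> P" "\<And>x. x \<in> S \<Longrightarrow> le (z x) (W (i x) (c x))"
    "\<And>x. x \<in> S \<Longrightarrow> le (z x) x" by metis
  \<comment> \<open>A common extension of \<open>z x\<close> and \<open>z y\<close> would make
    \<open>W (i x) (c x)\<close> compatible with \<open>y\<close>, which is sent past
    \<open>i x\<close>; but then \<open>c x\<close> would have been deleted at
    \<open>i x\<close>.\<close>
  have less: "\<not> compatible P le (z x) (z y)" if xy: "x \<in> S" "y \<in> S" "(i x, i y) \<in> ?r - Id" for x y
  proof
    assume "compatible P le (z x) (z y)"
    then have "compatible P le (W (i x) (c x)) y"
      by (rule compatible_mono[OF pre]) (use z W iS xy S(1) in auto)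
    then have "c x \<in> B (i x)" using xy by (auto simp: B_def N_def)
    then show False using c xy by blast
  qed
  have "\<not> compatible P le (z x) (z y)" if xy: "x \<in> S" "y \<in> S" "x \<noteq> y" for x y
  proof (cases "i x = i y")
    case True
    have "c x \<noteq> c y" using inj xy by (auto simp: inj_on_def)
    then have na: "\<not> compatible P le (W (i x) (c x)) (W (i x) (c y))" using anti iS xy by blast
    show ?thesis
    proof
      assume "compatible P le (z x) (z y)"
      then have "compatible P le (W (i x) (c x)) (W (i x) (c y))"
        by (rule compatible_mono[OF pre])
          (use z W iS xy in simp_all, use z(2)[OF xy(2)] True in simp)
      then show False using na by blast
    qed
  next
    case False
    then have "(i x, i y) \<in> ?r - Id \<or> (i y, i x) \<in> ?r - Id"
      using wo rS iS[OF xy(1)] iS[OF xy(2)] by (auto simp: order_on_defs total_on_def)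
    then show ?thesis using less[OF xy(1,2)] less[OF xy(2,1)] compatible_sym[of P le "z x" "z y"] by blast
  qed
  then show ?thesis using z by blast
qed

text \<open>Zorn's lemma for the antichains between \<open>A\<close> and \<open>L\<close>. No
  reflexivity is assumed of \<open>le\<close>, hence the premise that \<open>p\<close> is compatible
  with itself: it settles the case that \<open>p\<close> already belongs to
  \<open>M\<close>.\<close>

lemma ex_maximal_antichain:
  assumes "A \<subseteq> L" "\<And>p q. \<lbrakk>p \<in> A; q \<in> A; p \<noteq> q\<rbrakk> \<Longrightarrow> \<not> compatible P le p q"
  obtains M where "A \<subseteq> M" "M \<subseteq> L" "\<And>p q. \<lbrakk>p \<in> M; q \<in> M; p \<noteq> q\<rbrakk> \<Longrightarrow> \<not> compatible P le p q"
    "\<And>p. \<lbrakk>p \<in> L; compatible P le p p\<rbrakk> \<Longrightarrow> \<exists>q\<in>M. compatible P le p q"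
proof -
  define F where "F = {M. A \<subseteq> M \<and> M \<subseteq> L \<and> pairwise (\<lambda>p q. \<not> compatible P le p q) M}"
  have "\<exists>M\<in>F. \<forall>X\<in>F. M \<subseteq> X \<longrightarrow> X = M"
  proof (rule subset_Zorn_nonempty)
    have "A \<in> F" using assms by (auto simp: F_def pairwise_def)
    then show "F \<noteq> {}" by blast
    fix C assume C: "C \<noteq> {}" "subset.chain F C"
    have "pairwise (\<lambda>p q. \<not> compatible P le p q) (\<Union>C)"
    proof (rule pairwise_chain_Union)
      show "chain\<^sub>\<subseteq> C" using C(2) by (simp add: chain_subset_def subset_chain_def)
    qed (use C(2) in \<open>auto simp: F_def subset_chain_def\<close>)
    then show "\<Union>C \<in> F" using C by (auto simp: F_def subset_chain_def)
  qed
  then obtain M where M: "M \<in> F" and max: "\<And>X. \<lbrakk>X \<in> F; M \<subseteq> X\<rbrakk> \<Longrightarrow> X = M" by blast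
  show thesis
  proof (rule that)
    show "A \<subseteq> M" "M \<subseteq> L" using M by (auto simp: F_def)
    show "\<not> compatible P le p q" if "p \<in> M" "q \<in> M" "p \<noteq> q" for p q
      using M that by (auto simp: F_def pairwise_def)
    show "\<exists>q\<in>M. compatible P le p q" if p: "p \<in> L" "compatible P le p p" for p
    proof (rule ccontr)
      assume none: "\<not> (\<exists>q\<in>M. compatible P le p q)"
      then have "insert p M \<in> F"
        using M p(1) compatible_sym[of P le p] by (auto simp: F_def pairwise_insert)
      then show False using max[of "insert p M"] none p(2) by blast
    qed
  qed
qed

text \<open>The antichain is the set of immediate successors of a branch with lower bounds \<open>L\<close>.\<close>
lemma ex_successor_antichain:
  assumes fn: "forcing_notion P le" and closed: "aleph1_closed P le" and card: "|P| \<le>o continuum"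
    and L: "L \<subseteq> P" "L \<noteq> {}" "\<And>p q. \<lbrakk>p \<in> L; q \<in> P; le q p\<rbrakk> \<Longrightarrow> q \<in> L"
    and J: "|J| <o continuum"
  shows "\<exists>A :: nat set \<Rightarrow> 'a. (\<forall>c. A c \<in> L) \<and>
    (\<forall>c d. c \<noteq> d \<longrightarrow> \<not> compatible P le (A c) (A d)) \<and>
    (\<forall>p\<in>L. \<exists>c. compatible P le p (A c)) \<and>
    (\<forall>p\<in>J. (\<exists>r\<in>L. le r p) \<longrightarrow> p \<in> P \<longrightarrow> (\<exists>c. le (A c) p))"
proof -
  have refl: "\<And>p. p \<in> P \<Longrightarrow> le p p"
    and trans: "\<And>p q r. \<lbrakk>p \<in> P; q \<in> P; r \<in> P; le p q; le q r\<rbrakk> \<Longrightarrow> le p r"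
    and pre: "preorder_on_set P le"
    using fn unfolding forcing_notion_def preorder_on_set_def by blast+
  obtain W :: "'a \<Rightarrow> nat set \<Rightarrow> 'a"
    where W: "\<And>p c. p \<in> P \<Longrightarrow> W p c \<in> P \<and> le (W p c) p"
      and Wanti: "\<And>p c d. \<lbrakk>p \<in> P; c \<noteq> d\<rbrakk> \<Longrightarrow> \<not> compatible P le (W p c) (W p d)"
    using ex_continuum_antichain_below[OF fn closed] by metis
  obtain l where l: "l \<in> L" using L(2) by blast
  \<comment> \<open>\<open>s p\<close> is a condition of \<open>L\<close> below \<open>p\<close> if
    there is one; otherwise the default \<open>l\<close> keeps it in \<open>L\<close>.\<close>
  define s where "s p = (if \<exists>r\<in>L. le r p then SOME r. r \<in> L \<and> le r p else l)" for p
  have sL: "s p \<in> L" and sle: "\<exists>r\<in>L. le r p \<Longrightarrow> le (s p) p" for p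
  proof -
    have "s p \<in> L \<and> le (s p) p" if "\<exists>r\<in>L. le r p"
      using that someI_ex[of "\<lambda>r. r \<in> L \<and> le r p"] by (auto simp: s_def)
    then show "s p \<in> L" "\<exists>r\<in>L. le r p \<Longrightarrow> le (s p) p" using l by (auto simp: s_def)
  qed
  \<comment> \<open>Including \<open>l\<close> makes \<open>S\<close> nonempty even if
    \<open>J\<close> is empty, so that the antichain built from it always has continuum many
    members.\<close>
  define S where "S = insert l (s ` J)"
  have SL: "S \<subseteq> L" and SP: "S \<subseteq> P" using l sL L(1) by (auto simp: S_def)
  have "|s ` J| <o continuum" by (rule ordLeq_ordLess_trans[OF card_of_image J])
  moreover have "|{l}| <o continuum"
    using card_of_ordLeq_finite[of "UNIV :: nat set set" "{l}"] infinite_nat_set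
    by (auto simp: card_of_Well_order simp flip: not_ordLeq_iff_ordLess)
  ultimately have Scard: "|S| <o continuum"
    unfolding S_def using card_of_Un_ordLess_infinite[OF infinite_nat_set, of "{l}" "s ` J"] by simp
  obtain z where z: "\<And>x. x \<in> S \<Longrightarrow> z x \<in> P \<and> le (z x) x"
    and zanti: "\<And>x y. \<lbrakk>x \<in> S; y \<in> S; x \<noteq> y\<rbrakk> \<Longrightarrow> \<not> compatible P le (z x) (z y)"
    using disjoint_refinement[OF pre SP Scard, of W] W Wanti SP by (metis subsetD)
  \<comment> \<open>Each of the pairwise incompatible \<open>z x\<close> is split into continuum
    many incompatible extensions. The result is an antichain that is large and has members below
    every \<open>s p\<close> with \<open>p\<close> in \<open>J\<close>.\<close>
  define V where "V = {W (z x) c |x c. x \<in> S}"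
  have VL: "V \<subseteq> L"
    using z W L(3) SL unfolding V_def by blast
  have Vanti: "\<not> compatible P le p q" if pq: "p \<in> V" "q \<in> V" "p \<noteq> q" for p q
  proof
    assume comp: "compatible P le p q"
    obtain x c y d where xy: "x \<in> S" "y \<in> S" "p = W (z x) c" "q = W (z y) d"
      using pq by (auto simp: V_def)
    have "compatible P le (z x) (z y)"
      by (rule compatible_mono[OF pre comp]) (use xy W z in auto)
    then have "x = y" using zanti xy by blast
    then show False using Wanti[of "z x" c d] xy z pq(3) comp by auto
  qed
  obtain M where M: "V \<subseteq> M" "M \<subseteq> L" "\<And>p q. \<lbrakk>p \<in> M; q \<in> M; p \<noteq> q\<rbrakk> \<Longrightarrow> \<not> compatible P le p q"
    and Mmax: "\<And>p. \<lbrakk>p \<in> L; compatible P le p p\<rbrakk> \<Longrightarrow> \<exists>q\<in>M. compatible P le p q"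
    using ex_maximal_antichain[OF VL, of P le] Vanti by metis
  \<comment> \<open>Distinct indices give incompatible conditions, whereas equal conditions are
    compatible. So \<open>M\<close> has exactly the size of the continuum and can be indexed by sets
    of naturals.\<close>
  have "inj (W (z l))"
  proof (rule injI, rule ccontr)
    fix c d assume "W (z l) c = W (z l) d" "c \<noteq> d"
    then show False
      using Wanti[of "z l" c d] z[of l] W[of "z l" c] refl unfolding S_def compatible_def by auto
  qed
  moreover have "range (W (z l)) \<subseteq> M" using M(1) by (auto simp: V_def S_def)
  ultimately have "continuum \<le>o |M|" using card_of_ordLeq by blast
  moreover have "|M| \<le>o continuum"
    by (rule ordLeq_transitive[OF card_of_mono1 card]) (use M(2) L(1) in blast)
  ultimately have "continuum =o |M|" by (simp add: ordIso_iff_ordLeq)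
  then obtain A :: "nat set \<Rightarrow> 'a" where A: "bij_betw A UNIV M"
    using card_of_ordIso by blast
  have AM: "range A = M" and Ainj: "inj A" using A by (auto simp: bij_betw_def)
  show ?thesis
  proof (intro exI[of _ A] conjI allI ballI impI)
    show "A c \<in> L" for c using AM M(2) by blast
    show "\<not> compatible P le (A c) (A d)" if "c \<noteq> d" for c d
      using M(3)[of "A c" "A d"] AM Ainj that by (auto simp: inj_eq)
    show "\<exists>c. compatible P le p (A c)" if "p \<in> L" for p
    proof -
      have "compatible P le p p" using that L(1) refl by (auto simp: compatible_def)
      then show ?thesis using Mmax[OF that] AM by blast
    qed
    fix p assume p: "p \<in> J" "\<exists>r\<in>L. le r p" "p \<in> P"
    have sp: "s p \<in> S" using p(1) by (simp add: S_def)
    \<comment> \<open>Any index serves in place of \<open>{}\<close>: the condition lies below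
      \<open>z (s p)\<close>, hence below \<open>s p\<close>, hence below \<open>p\<close>.\<close>
    let ?w = "W (z (s p)) {}"
    have zP: "z (s p) \<in> P" "le (z (s p)) (s p)" using z[OF sp] by auto
    have "le ?w (s p)" by (rule trans[OF _ zP(1) _ _ zP(2)]) (use W[OF zP(1)] sp SP in auto)
    then have "le ?w p"
      by (rule trans[rotated 3, OF _ sle[OF p(2)]]) (use W[OF zP(1)] sp SP p(3) in auto)
    moreover have "?w \<in> M" using M(1) sp by (auto simp: V_def)
    ultimately show "\<exists>c. le (A c) p" using AM by auto
  qed
qed

section \<open>The dense tree\<close>

text \<open>A lower bound of a nonempty family below \<open>p\<close> is itself below
  \<open>p\<close>. Only the empty family, the start of a recursion, needs \<open>p\<close> as its
  own witness.\<close>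

lemma aleph1_closed_countable_below:
  assumes pre: "preorder_on_set P le" and closed: "aleph1_closed P le"
    and w: "Well_order w" and D: "D \<subseteq> Field w" "countable D" and p: "p \<in> P"
    and f: "\<And>i. i \<in> D \<Longrightarrow> f i \<in> P \<and> le (f i) p"
    and mono: "\<And>i j. \<lbrakk>i \<in> D; j \<in> D; (i, j) \<in> w\<rbrakk> \<Longrightarrow> le (f j) (f i)"
  shows "\<exists>q\<in>P. le q p \<and> (\<forall>i\<in>D. le q (f i))"
proof (cases "D = {}")
  case True
  moreover have "le p p" using pre p by (simp only: preorder_on_set_def)
  ultimately show ?thesis using p by blast
next
  case False
  then obtain i where i: "i \<in> D" by blast
  obtain q where q: "q \<in> P" "\<And>i. i \<in> D \<Longrightarrow> le q (f i)"
    by (rule aleph1_closed_countable[OF closed w D, of f]) (use f mono in auto)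
  have "le q p"
    using pre q(1) q(2)[OF i] f[OF i] p unfolding preorder_on_set_def by blast
  then show ?thesis using q by blast
qed

text \<open>\<open>(\<alpha>, s)\<close> stands for the sequence \<open>s\<close> restricted to the ordinals up to and including \<open>\<alpha>\<close>; the
  preorder ignores the values of \<open>s\<close> above \<open>\<alpha>\<close>.\<close>
definition tree_nodes :: "(nat set \<times> (nat set \<Rightarrow> nat set)) set" where
  "tree_nodes = Field aleph1 \<times> UNIV"

definition tree_le ::
  "nat set \<times> (nat set \<Rightarrow> nat set) \<Rightarrow> nat set \<times> (nat set \<Rightarrow> nat set) \<Rightarrow> bool" where
  "tree_le x y \<longleftrightarrow>
     (fst y, fst x) \<in> aleph1 \<and> (\<forall>\<gamma>. (\<gamma>, fst y) \<in> aleph1 \<longrightarrow> snd x \<gamma> = snd y \<gamma>)"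

lemma aleph1_refl: "\<alpha> \<in> Field aleph1 \<Longrightarrow> (\<alpha>, \<alpha>) \<in> aleph1"
  and aleph1_trans: "(\<alpha>, \<beta>) \<in> aleph1 \<Longrightarrow> (\<beta>, \<gamma>) \<in> aleph1 \<Longrightarrow> (\<alpha>, \<gamma>) \<in> aleph1"
  and aleph1_antisym: "(\<alpha>, \<beta>) \<in> aleph1 \<Longrightarrow> (\<beta>, \<alpha>) \<in> aleph1 \<Longrightarrow> \<alpha> = \<beta>"
  and aleph1_total: "\<alpha> \<in> Field aleph1 \<Longrightarrow> \<beta> \<in> Field aleph1 \<Longrightarrow> (\<alpha>, \<beta>) \<in> aleph1 \<or> (\<beta>, \<alpha>) \<in> aleph1"
  and aleph1_wf: "wf (aleph1 - Id)"
proof -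
  have *: "Refl aleph1" "trans aleph1" "antisym aleph1" "Total aleph1" "wf (aleph1 - Id)"
    using well_order_aleph1 by (auto simp: order_on_defs)
  show "\<alpha> \<in> Field aleph1 \<Longrightarrow> (\<alpha>, \<alpha>) \<in> aleph1" using *(1) by (rule refl_onD)
  show "(\<alpha>, \<beta>) \<in> aleph1 \<Longrightarrow> (\<beta>, \<gamma>) \<in> aleph1 \<Longrightarrow> (\<alpha>, \<gamma>) \<in> aleph1" using *(2) by (rule transD)
  show "(\<alpha>, \<beta>) \<in> aleph1 \<Longrightarrow> (\<beta>, \<alpha>) \<in> aleph1 \<Longrightarrow> \<alpha> = \<beta>" using *(3) by (rule antisymD)
  show "\<alpha> \<in> Field aleph1 \<Longrightarrow> \<beta> \<in> Field aleph1 \<Longrightarrow> (\<alpha>, \<beta>) \<in> aleph1 \<or> (\<beta>, \<alpha>) \<in> aleph1"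
    using *(1,4) by (cases "\<alpha> = \<beta>") (auto simp: total_on_def refl_on_def)
  show "wf (aleph1 - Id)" by (rule *(5))
qed

lemma aleph1_Field: "(\<alpha>, \<beta>) \<in> aleph1 \<Longrightarrow> \<alpha> \<in> Field aleph1" "(\<alpha>, \<beta>) \<in> aleph1 \<Longrightarrow> \<beta> \<in> Field aleph1"
  by (rule FieldI1, assumption) (rule FieldI2)

lemma preorder_tree: "preorder_on_set tree_nodes tree_le"
  unfolding preorder_on_set_def
proof (intro conjI ballI impI)
  show "tree_le x x" if "x \<in> tree_nodes" for x
    using that aleph1_refl by (auto simp: tree_nodes_def tree_le_def)
  show "tree_le x z" if "tree_le x y" "tree_le y z" for x y z
    using that aleph1_trans unfolding tree_le_def by (metis (no_types, lifting))
qed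

text \<open>The node \<open>(\<alpha>, s)\<close> is sent to \<open>F s \<alpha>\<close>, where
  \<open>F s\<close> follows the branch that at each level takes the member with index given by
  \<open>s\<close> from the antichain of successors.\<close>

lemma ex_tree_dense_embedding:
  assumes fn: "forcing_notion P le" and closed: "aleph1_closed P le" and card: "|P| \<le>o continuum"
    and J: "\<And>\<alpha>. \<alpha> \<in> Field aleph1 \<Longrightarrow> |J \<alpha>| <o continuum"
    and PJ: "P \<subseteq> (\<Union>\<alpha>\<in>Field aleph1. J \<alpha>)"
  shows "\<exists>e. dense_embedding tree_nodes tree_le P le e"
proof -
  have refl: "\<And>p. p \<in> P \<Longrightarrow> le p p"
    and trans: "\<And>p q r. \<lbrakk>p \<in> P; q \<in> P; r \<in> P; le p q; le q r\<rbrakk> \<Longrightarrow> le p r"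
    and pre: "preorder_on_set P le"
    using fn unfolding forcing_notion_def preorder_on_set_def by blast+
  \<comment> \<open>The properties of a set of lower bounds under which a successor antichain
    exists.\<close>
  define good where "good L \<longleftrightarrow> L \<subseteq> P \<and> L \<noteq> {} \<and> (\<forall>p\<in>L. \<forall>q\<in>P. le q p \<longrightarrow> q \<in> L)" for L
  define succ where "succ \<alpha> L A \<longleftrightarrow> (\<forall>c. A c \<in> L) \<and>
    (\<forall>c d. c \<noteq> d \<longrightarrow> \<not> compatible P le (A c) (A d)) \<and>
    (\<forall>p\<in>L. \<exists>c. compatible P le p (A c)) \<and>
    (\<forall>p\<in>J \<alpha>. (\<exists>r\<in>L. le r p) \<longrightarrow> p \<in> P \<longrightarrow> (\<exists>c. le (A c) p))"
    for \<alpha> L and A :: "nat set \<Rightarrow> 'a"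
  \<comment> \<open>The antichain is chosen from the level and the set \<open>L\<close> alone, so
    that branches with the same lower bounds share their successors.\<close>
  define A where "A \<alpha> L = (SOME A. succ \<alpha> L A)" for \<alpha> L
  have A: "succ \<alpha> L (A \<alpha> L)" if "\<alpha> \<in> Field aleph1" "good L" for \<alpha> L
    unfolding A_def using ex_successor_antichain[OF fn closed card, of L "J \<alpha>"] J that
    by (intro someI_ex[of "succ \<alpha> L"]) (simp add: good_def succ_def)
  note A = A[unfolded succ_def]
  have AL: "A \<alpha> L c \<in> L" if "\<alpha> \<in> Field aleph1" "good L" for \<alpha> L c
    using A[OF that, THEN conjunct1] by (rule spec)
  have Aanti: "\<not> compatible P le (A \<alpha> L c) (A \<alpha> L d)"
    if "\<alpha> \<in> Field aleph1" "good L" "c \<noteq> d" for \<alpha> L c d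
    using A[OF that(1,2), THEN conjunct2, THEN conjunct1] that(3) by blast
  have Amax: "\<exists>c. compatible P le p (A \<alpha> L c)"
    if "\<alpha> \<in> Field aleph1" "good L" "p \<in> L" for \<alpha> L p
    using A[OF that(1,2), THEN conjunct2, THEN conjunct2, THEN conjunct1] that(3) by blast
  have AJ: "\<exists>c. le (A \<alpha> L c) p"
    if "\<alpha> \<in> Field aleph1" "good L" "p \<in> J \<alpha>" "p \<in> P" "r \<in> L" "le r p" for \<alpha> L p r
    using A[OF that(1,2), THEN conjunct2, THEN conjunct2, THEN conjunct2] that(3-6) by blast
  \<comment> \<open>Only values strictly below \<alpha> count; at the least level this is all of
    \<open>P\<close>. Hence the equation for \<open>F\<close> below is a recursion.\<close>
  define LB where "LB \<alpha> f = {p \<in> P. \<forall>\<beta>\<in>underS aleph1 \<alpha>. le p (f \<beta>)}" for \<alpha> and f :: "nat set \<Rightarrow> 'a"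
  have LB_cong: "LB \<alpha> f = LB \<alpha> g" if "\<And>\<beta>. \<beta> \<in> underS aleph1 \<alpha> \<Longrightarrow> f \<beta> = g \<beta>" for \<alpha> f g
    using that by (auto simp: LB_def)
  have underS_iff: "\<beta> \<in> underS aleph1 \<alpha> \<longleftrightarrow> (\<beta>, \<alpha>) \<in> aleph1 - Id" for \<alpha> \<beta>
    by (auto simp: underS_def)
  have "\<exists>f. \<forall>\<alpha>. f \<alpha> = A \<alpha> (LB \<alpha> f) (s \<alpha>)" for s
  proof (rule dependent_wf_choice[OF aleph1_wf])
    fix f g :: "nat set \<Rightarrow> 'a" and \<alpha> p
    assume "\<And>\<beta>. (\<beta>, \<alpha>) \<in> aleph1 - Id \<Longrightarrow> f \<beta> = g \<beta>"
    then have "LB \<alpha> f = LB \<alpha> g" by (intro LB_cong) (simp add: underS_iff)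
    then show "(p = A \<alpha> (LB \<alpha> f) (s \<alpha>)) = (p = A \<alpha> (LB \<alpha> g) (s \<alpha>))" by simp
  qed blast
  then obtain F where F: "\<And>s \<alpha>. F s \<alpha> = A \<alpha> (LB \<alpha> (F s)) (s \<alpha>)" by metis
  \<comment> \<open>Nonemptiness is where closure enters: only countably many ordinals precede
    \<alpha>, and the values along them decrease.\<close>
  have good_LB: "good (LB \<alpha> f)"
    if fP: "\<And>\<beta>. \<beta> \<in> underS aleph1 \<alpha> \<Longrightarrow> f \<beta> \<in> P"
      and mono: "\<And>\<beta> \<gamma>. \<lbrakk>\<gamma> \<in> underS aleph1 \<alpha>; \<beta> \<in> underS aleph1 \<gamma>\<rbrakk> \<Longrightarrow> le (f \<gamma>) (f \<beta>)" for \<alpha> f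
    unfolding good_def
  proof (intro conjI ballI impI)
    show "LB \<alpha> f \<subseteq> P" by (auto simp: LB_def)
    show "q \<in> LB \<alpha> f" if "p \<in> LB \<alpha> f" "q \<in> P" "le q p" for p q
      using that trans[of q p] fP unfolding LB_def by blast
    obtain q where "q \<in> P" "\<And>\<beta>. \<beta> \<in> underS aleph1 \<alpha> \<Longrightarrow> le q (f \<beta>)"
    proof (rule aleph1_closed_countable[OF closed well_order_aleph1 _ countable_underS_aleph1, of \<alpha> f])
      show "underS aleph1 \<alpha> \<subseteq> Field aleph1" using aleph1_Field by (auto simp: underS_def)
      show "le (f \<gamma>) (f \<beta>)"
        if "\<beta> \<in> underS aleph1 \<alpha>" "\<gamma> \<in> underS aleph1 \<alpha>" "(\<beta>, \<gamma>) \<in> aleph1" for \<beta> \<gamma>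
        using that mono[of \<gamma> \<beta>] refl[OF fP] by (cases "\<beta> = \<gamma>") (auto simp: underS_iff)
    qed (use fP in auto)
    then show "LB \<alpha> f \<noteq> {}" by (auto simp: LB_def)
  qed
  have F_LB: "\<alpha> \<in> Field aleph1 \<longrightarrow> good (LB \<alpha> (F s)) \<and> F s \<alpha> \<in> LB \<alpha> (F s)" for s \<alpha>
  proof (induction \<alpha> rule: wf_induct_rule[OF aleph1_wf])
    case (1 \<alpha>)
    show ?case
    proof
      assume \<alpha>: "\<alpha> \<in> Field aleph1"
      have IH: "F s \<beta> \<in> LB \<beta> (F s)" if "\<beta> \<in> underS aleph1 \<alpha>" for \<beta>
        using 1 that aleph1_Field(1)[of \<beta> \<alpha>] by (simp add: underS_iff)
      have "good (LB \<alpha> (F s))"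
      proof (rule good_LB)
        show "F s \<beta> \<in> P" if "\<beta> \<in> underS aleph1 \<alpha>" for \<beta> using IH[OF that] by (simp add: LB_def)
        show "le (F s \<gamma>) (F s \<beta>)" if "\<gamma> \<in> underS aleph1 \<alpha>" "\<beta> \<in> underS aleph1 \<gamma>" for \<beta> \<gamma>
          using IH[OF that(1)] that(2) by (simp add: LB_def)
      qed
      then show "good (LB \<alpha> (F s)) \<and> F s \<alpha> \<in> LB \<alpha> (F s)" using AL[OF \<alpha>] F[of s \<alpha>] by simp
    qed
  qed
  have FP: "F s \<alpha> \<in> P" if "\<alpha> \<in> Field aleph1" for s \<alpha> using F_LB that by (simp add: LB_def)
  have F_mono: "le (F s \<alpha>) (F s \<beta>)" if "(\<beta>, \<alpha>) \<in> aleph1" for s \<alpha> \<beta>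
  proof (cases "\<beta> = \<alpha>")
    case True then show ?thesis using refl FP aleph1_Field(1)[OF that] by simp
  next
    case False then show ?thesis
      using F_LB[of \<alpha> s] aleph1_Field(2)[OF that] that by (simp add: LB_def underS_iff)
  qed
  \<comment> \<open>\<open>F s \<alpha>\<close> depends only on \<open>s\<close> up to and including
    \<alpha>, in accordance with the preorder of the tree.\<close>
  have F_cong: "(\<forall>\<gamma>. (\<gamma>, \<alpha>) \<in> aleph1 \<longrightarrow> s \<gamma> = t \<gamma>) \<longrightarrow> \<alpha> \<in> Field aleph1 \<longrightarrow> F s \<alpha> = F t \<alpha>" for s t \<alpha>
  proof (induction \<alpha> rule: wf_induct_rule[OF aleph1_wf])
    case (1 \<alpha>)
    show ?case
    proof (intro impI)
      assume eq: "\<forall>\<gamma>. (\<gamma>, \<alpha>) \<in> aleph1 \<longrightarrow> s \<gamma> = t \<gamma>" and \<alpha>: "\<alpha> \<in> Field aleph1"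
      have "LB \<alpha> (F s) = LB \<alpha> (F t)"
      proof (rule LB_cong)
        fix \<beta> assume "\<beta> \<in> underS aleph1 \<alpha>"
        then have \<beta>: "(\<beta>, \<alpha>) \<in> aleph1 - Id" by (simp add: underS_iff)
        then have "\<forall>\<gamma>. (\<gamma>, \<beta>) \<in> aleph1 \<longrightarrow> s \<gamma> = t \<gamma>" using eq aleph1_trans[of _ \<beta> \<alpha>] by simp
        then show "F s \<beta> = F t \<beta>" using 1[OF \<beta>] \<beta> aleph1_Field(1)[of \<beta> \<alpha>] by simp
      qed
      then show "F s \<alpha> = F t \<alpha>" using F[of s \<alpha>] F[of t \<alpha>] eq aleph1_refl[OF \<alpha>] by simp
    qed
  qed
  \<comment> \<open>Here agreement strictly below \<alpha> suffices, so the entry at \<alpha> may be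
    changed freely without affecting the available successors.\<close>
  have LB_F_cong: "LB \<alpha> (F s) = LB \<alpha> (F t)" if "\<And>\<gamma>. (\<gamma>, \<alpha>) \<in> aleph1 - Id \<Longrightarrow> s \<gamma> = t \<gamma>" for s t \<alpha>
  proof (rule LB_cong)
    fix \<beta> assume "\<beta> \<in> underS aleph1 \<alpha>"
    then have \<beta>: "(\<beta>, \<alpha>) \<in> aleph1" "\<beta> \<noteq> \<alpha>" by (simp_all add: underS_iff)
    have "s \<gamma> = t \<gamma>" if "(\<gamma>, \<beta>) \<in> aleph1" for \<gamma>
      using that aleph1_trans[OF that \<beta>(1)] aleph1_antisym[OF \<beta>(1)] \<beta>(2)
      by (intro \<open>\<And>\<gamma>. (\<gamma>, \<alpha>) \<in> aleph1 - Id \<Longrightarrow> s \<gamma> = t \<gamma>\<close>) auto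
    then show "F s \<beta> = F t \<beta>" using F_cong[of \<beta> s t] aleph1_Field(1)[OF \<beta>(1)] by simp
  qed
  \<comment> \<open>At a least difference \<gamma> both branches would take different members of the
    same antichain, while their values at \<gamma> are compatible, being weaker than those at
    \<alpha>.\<close>
  have F_compat: "s \<gamma> = t \<gamma>" if comp: "compatible P le (F s \<alpha>) (F t \<alpha>)" and "(\<gamma>, \<alpha>) \<in> aleph1" for s t \<alpha> \<gamma>
    using that(2)
  proof (induction \<gamma> rule: wf_induct_rule[OF aleph1_wf])
    case (1 \<gamma>)
    note \<gamma> = aleph1_Field[OF 1(2)]
    have L: "LB \<gamma> (F t) = LB \<gamma> (F s)"
      by (rule LB_F_cong) (use 1 aleph1_trans[of _ \<gamma> \<alpha>] in simp)
    have "compatible P le (F s \<gamma>) (F t \<gamma>)"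
      by (rule compatible_mono[OF pre comp]) (use F_mono 1(2) FP \<gamma> in simp_all)
    then show ?case
      using Aanti[OF \<gamma>(1), of "LB \<gamma> (F s)" "s \<gamma>" "t \<gamma>"] F_LB[of \<gamma> s] F[of s \<gamma>] F[of t \<gamma>] L \<gamma>(1)
      by auto
  qed
  have dense: "\<exists>\<alpha>\<in>Field aleph1. \<exists>s. le (F s \<alpha>) p" if p: "p \<in> P" for p
  proof -
    obtain \<alpha> where \<alpha>: "\<alpha> \<in> Field aleph1" "p \<in> J \<alpha>" using PJ p by blast
    \<comment> \<open>A recursion producing a branch \<open>snd \<circ> H\<close> together with
      decreasing conditions \<open>fst \<circ> H\<close> below \<open>p\<close>, the condition at
      \<beta> lying below the branch at \<beta>. It keeps the branch compatible with
      \<open>p\<close> until the level \<alpha> with \<open>p\<close> in \<open>J \<alpha>\<close>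
      is reached.\<close>
    define G where "G H \<beta> r \<longleftrightarrow> (\<beta> \<in> Field aleph1 \<longrightarrow> fst r \<in> P \<and> le (fst r) p \<and>
      (\<forall>\<gamma>\<in>underS aleph1 \<beta>. le (fst r) (fst (H \<gamma>))) \<and>
      le (fst r) (A \<beta> (LB \<beta> (F (snd \<circ> H))) (snd r)))" for H :: "nat set \<Rightarrow> 'a \<times> nat set" and \<beta> r
    have "\<exists>H. \<forall>\<beta>. G H \<beta> (H \<beta>)"
    proof (rule dependent_wf_choice[OF aleph1_wf])
      fix H H' :: "nat set \<Rightarrow> 'a \<times> nat set" and \<beta> r
      assume eq: "\<And>\<gamma>. (\<gamma>, \<beta>) \<in> aleph1 - Id \<Longrightarrow> H \<gamma> = H' \<gamma>"
      then have "LB \<beta> (F (snd \<circ> H)) = LB \<beta> (F (snd \<circ> H'))" by (intro LB_F_cong) simp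
      then show "G H \<beta> r = G H' \<beta> r" using eq by (simp add: G_def underS_iff)
    next
      fix \<beta> H assume IH: "\<And>\<gamma>. (\<gamma>, \<beta>) \<in> aleph1 - Id \<Longrightarrow> G H \<gamma> (H \<gamma>)"
      show "\<exists>r. G H \<beta> r"
      proof (cases "\<beta> \<in> Field aleph1")
        case True
        let ?L = "LB \<beta> (F (snd \<circ> H))"
        have H: "fst (H \<gamma>) \<in> P" "le (fst (H \<gamma>)) p" "le (fst (H \<gamma>)) (F (snd \<circ> H) \<gamma>)"
          "\<And>\<delta>. \<delta> \<in> underS aleph1 \<gamma> \<Longrightarrow> le (fst (H \<gamma>)) (fst (H \<delta>))"
          if "\<gamma> \<in> underS aleph1 \<beta>" for \<gamma>
          using IH[of \<gamma>] that aleph1_Field(1)[of \<gamma> \<beta>] F[of "snd \<circ> H" \<gamma>] by (simp_all add: G_def underS_iff)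
        have "\<exists>q\<in>P. le q p \<and> (\<forall>\<gamma>\<in>underS aleph1 \<beta>. le q (fst (H \<gamma>)))"
        proof (rule aleph1_closed_countable_below[OF pre closed well_order_aleph1 _ countable_underS_aleph1 p])
          show "underS aleph1 \<beta> \<subseteq> Field aleph1" using aleph1_Field by (auto simp: underS_def)
          show "le (fst (H \<delta>)) (fst (H \<gamma>))"
            if "\<gamma> \<in> underS aleph1 \<beta>" "\<delta> \<in> underS aleph1 \<beta>" "(\<gamma>, \<delta>) \<in> aleph1" for \<gamma> \<delta>
            using that H(4)[of \<delta> \<gamma>] refl[OF H(1)] by (cases "\<gamma> = \<delta>") (auto simp: underS_iff)
        qed (use H in auto)
        then obtain q where q: "q \<in> P" "le q p" "\<And>\<gamma>. \<gamma> \<in> underS aleph1 \<beta> \<Longrightarrow> le q (fst (H \<gamma>))"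
          by blast
        have "le q (F (snd \<circ> H) \<gamma>)" if \<gamma>: "\<gamma> \<in> underS aleph1 \<beta>" for \<gamma>
          by (rule trans[OF q(1) H(1)[OF \<gamma>] _ q(3)[OF \<gamma>] H(3)[OF \<gamma>]])
            (use FP \<gamma> aleph1_Field(1)[of \<gamma> \<beta>] in \<open>simp add: underS_iff\<close>)
        then have "q \<in> ?L" using q(1) by (simp add: LB_def)
        \<comment> \<open>By maximality of the antichain \<open>q\<close> meets some successor; its
          index \<open>c\<close> prolongs the branch, and a common extension is the next
          condition.\<close>
        then obtain c where "compatible P le q (A \<beta> ?L c)"
          using Amax[OF True] F_LB[of \<beta> "snd \<circ> H"] True by blast
        then obtain r where r: "r \<in> P" "le r q" "le r (A \<beta> ?L c)" by (auto simp: compatible_def)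
        have "le r p" by (rule trans[OF r(1) q(1) p r(2) q(2)])
        moreover have "le r (fst (H \<gamma>))" if \<gamma>: "\<gamma> \<in> underS aleph1 \<beta>" for \<gamma>
          by (rule trans[OF r(1) q(1) H(1)[OF \<gamma>] r(2) q(3)[OF \<gamma>]])
        ultimately have "G H \<beta> (r, c)" using r by (simp add: G_def)
        then show ?thesis ..
      qed (simp add: G_def)
    qed
    then obtain H where "\<forall>\<beta>. G H \<beta> (H \<beta>)" ..
    then have H: "fst (H \<beta>) \<in> P" "le (fst (H \<beta>)) p" "le (fst (H \<beta>)) (F (snd \<circ> H) \<beta>)"
      "\<And>\<gamma>. \<gamma> \<in> underS aleph1 \<beta> \<Longrightarrow> le (fst (H \<beta>)) (fst (H \<gamma>))" if "\<beta> \<in> Field aleph1" for \<beta>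
      using that F[of "snd \<circ> H" \<beta>] by (simp_all add: G_def)
    let ?L = "LB \<alpha> (F (snd \<circ> H))"
    have "le (fst (H \<alpha>)) (F (snd \<circ> H) \<beta>)" if "\<beta> \<in> underS aleph1 \<alpha>" for \<beta>
    proof -
      have \<beta>: "\<beta> \<in> Field aleph1" using that aleph1_Field(1)[of \<beta> \<alpha>] by (simp add: underS_iff)
      show ?thesis by (rule trans[OF H(1)[OF \<alpha>(1)] H(1)[OF \<beta>] FP[OF \<beta>] H(4)[OF \<alpha>(1) that] H(3)[OF \<beta>]])
    qed
    then have "fst (H \<alpha>) \<in> ?L" using H(1)[OF \<alpha>(1)] by (simp add: LB_def)
    \<comment> \<open>\<open>fst (H \<alpha>)\<close> is a lower bound of the branch lying below
      \<open>p\<close>, so the antichain at level \<alpha>, which takes care of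
      \<open>J \<alpha>\<close>, has a member below \<open>p\<close>.\<close>
    then obtain c where c: "le (A \<alpha> ?L c) p"
      using AJ[OF \<alpha>(1) _ \<alpha>(2) p _ H(2)[OF \<alpha>(1)]] F_LB[of \<alpha> "snd \<circ> H"] \<alpha>(1) by blast
    \<comment> \<open>The successor found need not be the one that \<open>H\<close> took at
      \<alpha>, so the branch is redirected there.\<close>
    let ?s = "(snd \<circ> H)(\<alpha> := c)"
    have "LB \<alpha> (F ?s) = ?L" by (rule LB_F_cong) auto
    then have "F ?s \<alpha> = A \<alpha> ?L c" using F[of ?s \<alpha>] by simp
    then have "le (F ?s \<alpha>) p" using c by simp
    then show ?thesis using \<alpha>(1) by blast
  qed
  \<comment> \<open>Nodes with compatible images are comparable: weakening the longer branch to
    level \<beta> shows that both sequences agree up to \<beta>, so the longer node is itself a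
    common extension.\<close>
  have aux: "compatible tree_nodes tree_le (\<alpha>, s) (\<beta>, t)"
    if comp: "compatible P le (F s \<alpha>) (F t \<beta>)" and le: "(\<beta>, \<alpha>) \<in> aleph1" for \<alpha> \<beta> s t
  proof -
    note \<alpha> = aleph1_Field(2)[OF le] and \<beta> = aleph1_Field(1)[OF le]
    have "compatible P le (F s \<beta>) (F t \<beta>)"
      by (rule compatible_mono[OF pre comp F_mono[OF le] refl]) (use FP \<alpha> \<beta> in simp_all)
    then have "tree_le (\<alpha>, s) (\<beta>, t)" using F_compat[of s \<beta> t] le by (simp add: tree_le_def)
    moreover have "tree_le (\<alpha>, s) (\<alpha>, s)" using aleph1_refl[OF \<alpha>] by (simp add: tree_le_def)
    ultimately show ?thesis using \<alpha> by (auto simp: compatible_def tree_nodes_def)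
  qed
  have "dense_embedding tree_nodes tree_le P le (\<lambda>x. F (snd x) (fst x))"
    unfolding dense_embedding_def
  proof (intro conjI ballI impI)
    show "(\<lambda>x. F (snd x) (fst x)) ` tree_nodes \<subseteq> P" using FP by (auto simp: tree_nodes_def)
    show "le (F (snd x) (fst x)) (F (snd y) (fst y))"
      if "x \<in> tree_nodes" "y \<in> tree_nodes" "tree_le x y" for x y
    proof -
      have "F (snd x) (fst y) = F (snd y) (fst y)"
        using F_cong[of "fst y" "snd x" "snd y"] that by (auto simp: tree_le_def tree_nodes_def)
      moreover have "le (F (snd x) (fst x)) (F (snd x) (fst y))"
        using that(3) by (intro F_mono) (simp add: tree_le_def)
      ultimately show ?thesis by simp
    qed
    show "compatible tree_nodes tree_le x y"
      if "x \<in> tree_nodes" "y \<in> tree_nodes" "compatible P le (F (snd x) (fst x)) (F (snd y) (fst y))" for x y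
    proof -
      have "(fst y, fst x) \<in> aleph1 \<or> (fst x, fst y) \<in> aleph1"
        using that(1,2) aleph1_total[of "fst y" "fst x"] by (auto simp: tree_nodes_def)
      then show ?thesis
        using aux[of "snd x" "fst x" "snd y" "fst y"] aux[of "snd y" "fst y" "snd x" "fst x"] that(3)
          compatible_sym[of P le "F (snd x) (fst x)"] compatible_sym[of tree_nodes tree_le x y]
        by auto
    qed
    show "\<exists>x\<in>tree_nodes. le (F (snd x) (fst x)) p" if "p \<in> P" for p
    proof -
      obtain \<alpha> s where "\<alpha> \<in> Field aleph1" "le (F s \<alpha>) p" using dense \<open>p \<in> P\<close> by blast
      then show ?thesis by (intro bexI[of _ "(\<alpha>, s)"]) (simp_all add: tree_nodes_def)
    qed
  qed
  then show ?thesis by (rule exI[where x = "\<lambda>x. F (snd x) (fst x)"])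
qed

section \<open>Cohen forcing\<close>

lemma Add_iff: "p \<in> Add_aleph1 \<longleftrightarrow> dom p \<subseteq> Field aleph1 \<and> countable (dom p)"
  by (simp add: Add_aleph1_def card_of_less_aleph1_iff)

lemma Add_update:
  assumes "p \<in> Add_aleph1" "\<alpha> \<in> Field aleph1"
  shows "p(\<alpha> \<mapsto> b) \<in> Add_aleph1"
  using assms by (simp add: Add_iff)

lemma Add_le_update: "\<alpha> \<notin> dom p \<Longrightarrow> Add_le (p(\<alpha> \<mapsto> b)) p"
  by (auto simp: Add_le_def map_le_def)

lemma Add_incompatible:
  assumes "p \<alpha> = Some b" "q \<alpha> = Some c" "b \<noteq> c"
  shows "\<not> compatible Add_aleph1 Add_le p q"
proof
  assume "compatible Add_aleph1 Add_le p q"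
  then obtain r where "p \<subseteq>\<^sub>m r" "q \<subseteq>\<^sub>m r" by (auto simp: compatible_def Add_le_def)
  then have "r \<alpha> = Some b" "r \<alpha> = Some c" using assms by (metis domI map_le_def)+
  then show False using assms(3) by simp
qed

lemma forcing_notion_Add: "forcing_notion Add_aleph1 Add_le"
  unfolding forcing_notion_def
proof (intro conjI ballI impI)
  have "Map.empty \<in> Add_aleph1" by (simp add: Add_iff)
  then show "Add_aleph1 \<noteq> {}" by blast
  show "Add_le p p" for p by (simp add: Add_le_def)
  show "Add_le p r" if "Add_le p q" "Add_le q r" for p q r
    using that unfolding Add_le_def by (rule map_le_trans[rotated])
  show "separative Add_aleph1 Add_le"
    unfolding separative_def
  proof (intro ballI impI)
    fix p q assume pq: "p \<in> Add_aleph1" "q \<in> Add_aleph1" "\<not> Add_le p q"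
    then obtain \<alpha> b where \<alpha>: "q \<alpha> = Some b" "p \<alpha> \<noteq> Some b"
      by (auto simp: Add_le_def map_le_def)
    \<comment> \<open>If \<open>p\<close> is undefined at \<alpha>, it is extended by the value
      opposite to that of \<open>q\<close>; otherwise \<open>p\<close> itself already disagrees with
      \<open>q\<close>.\<close>
    show "\<exists>r\<in>Add_aleph1. Add_le r p \<and> \<not> compatible Add_aleph1 Add_le r q"
    proof (cases "p \<alpha>")
      case None
      have "\<alpha> \<in> Field aleph1" using pq(2) \<alpha>(1) unfolding Add_iff by blast
      then have "p(\<alpha> \<mapsto> \<not> b) \<in> Add_aleph1" using Add_update pq(1) by blast
      moreover have "Add_le (p(\<alpha> \<mapsto> \<not> b)) p" using None by (intro Add_le_update) auto
      moreover have "\<not> compatible Add_aleph1 Add_le (p(\<alpha> \<mapsto> \<not> b)) q"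
        by (rule Add_incompatible[of _ \<alpha> "\<not> b" _ b]) (use \<alpha>(1) in auto)
      ultimately show ?thesis by blast
    next
      case (Some c)
      have "\<not> compatible Add_aleph1 Add_le p q"
        by (rule Add_incompatible[of p \<alpha> c q b]) (use \<alpha> Some in auto)
      moreover have "Add_le p p" by (simp add: Add_le_def)
      ultimately show ?thesis using pq(1) by blast
    qed
  qed
  show "nontrivial Add_aleph1 Add_le"
    unfolding nontrivial_def
  proof
    fix p assume p: "p \<in> Add_aleph1"
    \<comment> \<open>A countable domain misses some point of \<omega>_1, and the two values there
      split \<open>p\<close>.\<close>
    have "\<not> Field aleph1 \<subseteq> dom p"
      using p uncountable_Field_aleph1 countable_subset unfolding Add_iff by blast
    then obtain \<alpha> where \<alpha>: "\<alpha> \<in> Field aleph1" "\<alpha> \<notin> dom p" by blast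
    have "\<not> compatible Add_aleph1 Add_le (p(\<alpha> \<mapsto> True)) (p(\<alpha> \<mapsto> False))"
      by (rule Add_incompatible[of _ \<alpha> True _ False]) auto
    then show "\<exists>q\<in>Add_aleph1. \<exists>r\<in>Add_aleph1.
        Add_le q p \<and> Add_le r p \<and> \<not> compatible Add_aleph1 Add_le q r"
      using Add_update[OF p \<alpha>(1)] Add_le_update[OF \<alpha>(2)] by blast
  qed
qed

text \<open>The union of the sequence is a lower bound: its members are pairwise comparable, and a
  countable union of countable domains is countable.\<close>

lemma aleph1_closed_Add: "aleph1_closed Add_aleph1 Add_le"
  unfolding aleph1_closed_def
proof (intro allI impI)
  fix r :: "nat rel" and f :: "nat \<Rightarrow> nat set \<Rightarrow> bool option"
  assume wo: "Well_order r" and f: "f ` Field r \<subseteq> Add_aleph1"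
    and dec: "\<forall>i j. (i, j) \<in> r \<longrightarrow> Add_le (f j) (f i)"
  have tot: "(i, j) \<in> r \<or> (j, i) \<in> r \<or> i = j" if "i \<in> Field r" "j \<in> Field r" for i j
    using wo that by (auto simp: order_on_defs total_on_def)
  have agree: "f i x = f j x"
    if ij: "i \<in> Field r" "j \<in> Field r" and x: "x \<in> dom (f i)" "x \<in> dom (f j)" for i j x
    using tot[OF ij] dec x unfolding Add_le_def map_le_def by metis
  \<comment> \<open>The union of the functions \<open>f i\<close>; by \<open>agree\<close> the
    choice of \<open>i\<close> does not affect the value.\<close>
  define q where "q x = (if \<exists>i\<in>Field r. x \<in> dom (f i)
    then f (SOME i. i \<in> Field r \<and> x \<in> dom (f i)) x else None)" for x
  have q: "q x = f i x" if "i \<in> Field r" "x \<in> dom (f i)" for i x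
  proof -
    have "\<exists>i. i \<in> Field r \<and> x \<in> dom (f i)" using that by blast
    from someI_ex[OF this] have "f (SOME i. i \<in> Field r \<and> x \<in> dom (f i)) x = f i x"
      using agree that by blast
    then show ?thesis using that by (auto simp: q_def)
  qed
  have "dom q \<subseteq> (\<Union>i\<in>Field r. dom (f i))"
    by (auto simp: q_def split: if_splits)
  moreover have "countable (\<Union>i\<in>Field r. dom (f i))" "(\<Union>i\<in>Field r. dom (f i)) \<subseteq> Field aleph1"
    using f by (auto simp: Add_iff image_subset_iff)
  ultimately have "q \<in> Add_aleph1" unfolding Add_iff using countable_subset by blast
  moreover have "Add_le q (f i)" if "i \<in> Field r" for i
    using q[OF that] by (simp add: Add_le_def map_le_def)
  ultimately show "\<exists>q\<in>Add_aleph1. \<forall>i\<in>Field r. Add_le q (f i)" by blast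
qed

text \<open>A condition is coded by an enumeration \<open>g p\<close> of its graph; \<open>(0, 0)\<close> is in every code but
  that of the empty condition, whose graph has no enumeration.\<close>
lemma card_of_Add: "|Add_aleph1| \<le>o continuum"
proof -
  have "\<exists>g :: nat \<Rightarrow> nat set \<times> bool. p = Map.empty \<or> range g = Map.graph p"
    if "p \<in> Add_aleph1" for p
  proof (cases "p = Map.empty")
    case False
    have "countable (Map.graph p)"
      using that by (simp add: Add_iff graph_eq_to_snd_dom)
    moreover have "Map.graph p \<noteq> {}" using False by (auto simp: Map.graph_def)
    ultimately show ?thesis by (metis range_from_nat_into)
  qed simp
  then obtain g :: "(nat set \<Rightarrow> bool option) \<Rightarrow> nat \<Rightarrow> nat set \<times> bool"
    where g: "\<And>p. p \<in> Add_aleph1 \<Longrightarrow> p = Map.empty \<or> range (g p) = Map.graph p" by metis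
  \<comment> \<open>\<open>(n, Suc (Suc m))\<close> records that \<open>m\<close> belongs to the
    point in the \<open>n\<close>-th entry of the enumeration, \<open>(n, Suc 0)\<close> that the
    value there is \<open>True\<close>.\<close>
  define code where "code p = (if p = Map.empty then {} else
    insert (0, 0) ({(n, Suc (Suc m)) |n m. m \<in> fst (g p n)} \<union> {(n, Suc 0) |n. snd (g p n)}))" for p
  have "inj_on code Add_aleph1"
  proof (rule inj_onI)
    fix p q assume pq: "p \<in> Add_aleph1" "q \<in> Add_aleph1" "code p = code q"
    have empty: "code p = {} \<longleftrightarrow> p = Map.empty" for p by (simp add: code_def)
    show "p = q"
    proof (cases "p = Map.empty")
      case True
      then show ?thesis using pq(3) empty by metis
    next
      case False
      then have ne: "p \<noteq> Map.empty" "q \<noteq> Map.empty" using pq(3) empty by metis+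
      have mem: "m \<in> fst (g p n) \<longleftrightarrow> (n, Suc (Suc m)) \<in> code p" "snd (g p n) \<longleftrightarrow> (n, Suc 0) \<in> code p"
        if "p \<noteq> Map.empty" for p n m
        using that by (auto simp: code_def)
      have "g p n = g q n" for n
        using mem(1)[OF ne(1), of _ n] mem(1)[OF ne(2), of _ n]
          mem(2)[OF ne(1), of n] mem(2)[OF ne(2), of n] pq(3) by (intro prod_eqI) auto
      then have "g p = g q" by blast
      then have "Map.graph p = Map.graph q" using g[OF pq(1)] g[OF pq(2)] ne by simp
      then have "p x = Some b \<longleftrightarrow> q x = Some b" for x b
        by (auto simp: Map.graph_def set_eq_iff)
      then show ?thesis by (metis ext not_Some_eq)
    qed
  qed
  then have "|Add_aleph1| \<le>o |UNIV :: (nat \<times> nat) set set|"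
    using card_of_ordLeqI by blast
  also have "|UNIV :: (nat \<times> nat) set set| \<le>o continuum"
  proof (rule card_of_ordLeqI)
    show "inj_on (image to_nat) (UNIV :: (nat \<times> nat) set set)"
      by (rule inj_on_image) (simp add: inj_on_subset[OF inj_to_nat])
  qed simp
  finally show ?thesis .
qed

section \<open>The filtration from the cofinality, and the conclusion\<close>

text \<open>Code \<open>P\<close> injectively by elements of the continuum, cut at the points of a
  cofinal set enumerated along \<omega>_1. Proper initial segments of a cardinal are smaller than
  it.\<close>

lemma ex_small_filtration:
  assumes cof: "has_cofinality continuum aleph1" and card: "|P| \<le>o continuum"
  shows "\<exists>J. (\<forall>\<alpha>\<in>Field aleph1. |J \<alpha>| <o continuum) \<and> P \<subseteq> (\<Union>\<alpha>\<in>Field aleph1. J \<alpha>)"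
proof -
  obtain X where X: "cofinal_in continuum X" "|X| =o aleph1"
    using cof unfolding has_cofinality_def by blast
  have "|Field aleph1| =o |X|"
    by (rule ordIso_transitive[OF card_of_Field_ordIso[OF card_order_aleph1] ordIso_symmetric[OF X(2)]])
  then obtain g where g: "bij_betw g (Field aleph1) X" using card_of_ordIso by blast
  obtain h where h: "inj_on h P" "h ` P \<subseteq> (UNIV :: nat set set)"
    using card card_of_ordLeq[of P "UNIV :: nat set set"] by blast
  define J where "J \<alpha> = {p \<in> P. h p \<in> underS continuum (g \<alpha>)}" for \<alpha>
  have "|J \<alpha>| <o continuum" for \<alpha>
  proof -
    have "|J \<alpha>| \<le>o |underS continuum (g \<alpha>)|"
      by (rule card_of_ordLeqI[of h]) (use h(1) in \<open>auto simp: J_def inj_on_def\<close>)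
    then show ?thesis
      by (rule ordLeq_ordLess_trans) (rule card_of_underS; simp add: card_of_card_order_on Field_card_of)
  qed
  moreover have "P \<subseteq> (\<Union>\<alpha>\<in>Field aleph1. J \<alpha>)"
  proof
    fix p assume p: "p \<in> P"
    \<comment> \<open>The segments are strict while cofinality gives only a weak inequality, so a
      point strictly above \<open>h p\<close> is taken first.\<close>
    obtain b where b: "h p \<noteq> b" "(h p, b) \<in> continuum"
      using infinite_Card_order_limit[of continuum "h p"] infinite_nat_set
      by (auto simp: card_of_card_order_on Field_card_of)
    obtain x where x: "x \<in> X" "(b, x) \<in> continuum"
      using X(1) unfolding cofinal_in_def by (auto simp: Field_card_of)
    obtain \<alpha> where \<alpha>: "\<alpha> \<in> Field aleph1" "x = g \<alpha>" using g x(1) by (auto simp: bij_betw_def)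
    have "trans continuum" "antisym continuum"
      using card_of_Well_order[of "UNIV :: nat set set"] by (auto simp: order_on_defs)
    then have "(h p, x) \<in> continuum" "h p \<noteq> x"
      using b x(2) by (meson transD, metis antisymD)
    then have "p \<in> J \<alpha>" using p \<alpha>(2) by (simp add: J_def underS_def)
    then show "p \<in> (\<Union>\<alpha>\<in>Field aleph1. J \<alpha>)" using \<alpha>(1) by blast
  qed
  ultimately show ?thesis by blast
qed

text \<open>The tree does not depend on \<open>P\<close>, so this applies to the given forcing
  notion and to \<open>Add_aleph1\<close> with the same right-hand side.\<close>

lemma forcing_equivalent_tree:
  assumes cof: "has_cofinality continuum aleph1"
    and fn: "forcing_notion P le" and closed: "aleph1_closed P le" and card: "|P| \<le>o continuum"
  shows "forcing_equivalent P le tree_nodes tree_le"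
proof -
  obtain J where J: "\<forall>\<alpha>\<in>Field aleph1. |J \<alpha>| <o continuum" "P \<subseteq> (\<Union>\<alpha>\<in>Field aleph1. J \<alpha>)"
    using ex_small_filtration[OF cof card] by (elim exE conjE)
  have "\<exists>e. dense_embedding tree_nodes tree_le P le e"
    by (rule ex_tree_dense_embedding[OF fn closed card _ J(2)]) (rule bspec[OF J(1)])
  then obtain e where "dense_embedding tree_nodes tree_le P le e" ..
  moreover have "preorder_on_set P le"
    using fn unfolding forcing_notion_def preorder_on_set_def by blast
  ultimately show ?thesis by (intro dense_embedding_forcing_equivalent preorder_tree)
qed

theorem theorem1p1:
  fixes P :: "'a set" and le :: "'a \<Rightarrow> 'a \<Rightarrow> bool"
  assumes "has_cofinality continuum aleph1"
    and "forcing_notion P le"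
    and "aleph1_closed P le"
    and "(card_of P, continuum) \<in> ordLeq"
  shows "forcing_equivalent P le Add_aleph1 Add_le"
proof (rule forcing_equivalent_trans)
  show "forcing_equivalent P le tree_nodes tree_le"
    by (rule forcing_equivalent_tree[OF assms])
  show "forcing_equivalent tree_nodes tree_le Add_aleph1 Add_le"
    by (rule forcing_equivalent_sym, rule forcing_equivalent_tree[OF assms(1)])
      (rule forcing_notion_Add aleph1_closed_Add card_of_Add)+
qed

end
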